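(* Let $N\ge 3$ be an integer, $k_1,k_2\in\{1,2,\dots,N\}$, and let $a_1\ge 0$, $a_2\ge 0$ with $a_1+a_2>0$. Let $b_1,b_2,p_1,p_2:[0,\infty)\to[0,\infty)$ be continuous functions, viewed as radial functions $b_i(|x|)$, $p_i(|x|)$ on $\mathbb{R}^N$, and let $f_1,f_2:[0,\infty)\times[0,\infty)\to[0,\infty)$ be continuous and strictly increasing in each variable. Let $P_1,P_2,F_{1,2}$ and $P_1(\infty),P_2(\infty),F_{1,2}(\infty)$ be the functions and limits defined in the context from these data. Assume $F_{1,2}(\infty)<\infty$, $P_1(\infty)+P_2(\infty)<\infty$ and $P_1(\infty)+P_2(\infty)<F_{1,2}(\infty)$. Then the system $$ \left\{ \begin{array}{l} S_{k_1}\left(\lambda(D^2u_1)\right)+b_1(|x|)\,|\nabla u_1|^{k_1}=p_1(|x|)\,f_1(u_1,u_2),\quad x\in\mathbb{R}^N,\\ S_{k_2}\left(\lambda(D^2u_2)\right)+b_2(|x|)\,|\nabla u_2|^{k_2}=p_2(|x|)\,f_2(u_1,u_2),\quad x\in\mathbb{R}^N, \end{array} \right. $$ has a positive bounded radial solution $(u_1,u_2)\in C^2([0,\infty))\times C^2([0,\infty))$ with central value $(u_1(0),u_2(0))=(a_1,a_2)$, such that for all $r\ge 0$ $$ \left\{ \begin{array}{l} a_1+f_1^{1/k_1}(a_1,a_2)\,P_1(r)\le u_1(r)\le F_{1,2}^{-1}\left(P_1(r)+P_2(r)\right),\\ a_2+f_2^{1/k_2}(a_1,a_2)\,P_2(r)\le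 u_2(r)\le F_{1,2}^{-1}\left(P_1(r)+P_2(r)\right). \end{array} \right. $$
   Context: For a $C^2$ function $u$, $S_k(\lambda(D^2u))$ denotes the $k$-Hessian operator, i.e. the sum of all $k\times k$ principal minors of the Hessian matrix $D^2u$ (equivalently the $k$-th elementary symmetric polynomial of its eigenvalues $\lambda(D^2u)$); $S_1$ is the Laplacian and $S_N$ the Monge–Ampère operator. A radial solution is one of the form $u_i(x)=u_i(r)$ with $r=|x|$, and $u_i$ is identified with the function of $r\in[0,\infty)$. Notation, for $\xi>0$, $r\ge 0$: $$C_0=\frac{(N-1)!}{k_1!\,(N-k_1)!},\qquad C_{00}=\frac{(N-1)!}{k_2!\,(N-k_2)!},$$ $$B_1^-(\xi)=\frac{\xi^{k_1-N}}{C_0}\,e^{-\int_0^\xi\frac{1}{C_0}t^{k_1-1}b_1(t)\,dt},\qquad B_1^+(\xi)=\xi^{N-1}e^{\int_0^\xi\frac{1}{C_0}t^{k_1-1}b_1(t)\,dt}\,p_1(\xi),$$ $$B_2^-(\xi)=\frac{\xi^{k_2-N}}{C_{00}}\,e^{-\int_0^\xi\frac{1}{C_{00}}t^{k_2-1}b_2(t)\,dt},\qquad B_2^+(\xi)=\xi^{N-1}e^{\int_0^\xi\frac{1}{C_{00}}t^{k_2-1}b_2(t)\,dt}\,p_2(\xi),$$ $$P_i(r)=\int_0^r\left(B_i^-(y)\int_0^y B_i^+(t)\,dt\right)^{1/k_i}dy\quad(i=1,2),$$ $$F_{1,2}(r)=\int_{a_1+a_2}^r\frac{dt}{f_1^{1/k_1}(t,t)+f_2^{1/k_2}(t,t)}\quad\text{for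 } r\ge a_1+a_2,$$ where $f_i^{1/k_i}(s,t)=(f_i(s,t))^{1/k_i}$, and $$P_i(\infty)=\lim_{r\to\infty}P_i(r)\in[0,\infty],\qquad F_{1,2}(\infty)=\lim_{s\to\infty}F_{1,2}(s)\in(0,\infty].$$ $F_{1,2}^{-1}:[0,F_{1,2}(\infty))\to[a_1+a_2,\infty)$ denotes the inverse function of $F_{1,2}$.
   Formalization: Added for i=1,2: k_i=1 or p_i(0)>0 or P_i in C^2([0,∞)); otherwise u_i need not be C^2 (e.g. k_i=2, p_i=0 on [0,1], then linear). "Positive" is read as u_i≥0, with u_i(r)>0 wherever a_i>0 or P_i(r)>0, since a_i=0 is allowed. *)

theory Defs
  imports "HOL-Analysis.Analysis"
begin

(* The determinant of the submatrix (A_ij), i, j in I: the Leibniz formula of the library's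
   det, with the index type replaced by the index set I. *)
definition principal_minor :: "real ^ 'n ^ 'n \<Rightarrow> 'n set \<Rightarrow> real" where
  "principal_minor A I = (\<Sum>\<pi> | \<pi> permutes I. of_int (sign \<pi>) * (\<Prod>i\<in>I. A $ i $ \<pi> i))"

lemma principal_minor_UNIV: "principal_minor A UNIV = det A"
  by (simp add: principal_minor_def det_def)

definition sum_principal_minors :: "nat \<Rightarrow> real ^ 'n ^ 'n \<Rightarrow> real" where
  "sum_principal_minors k A = (\<Sum>I | card I = k. principal_minor A I)"

lemma sum_principal_minors_1: "sum_principal_minors 1 A = trace A"
proof -
  have eq: "{I :: 'n set. card I = 1} = (\<lambda>i. {i}) ` UNIV"
    by (auto simp: card_Suc_eq)
  show ?thesis
    by (simp only: sum_principal_minors_def eq)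
       (simp add: sum.reindex principal_minor_def trace_def)
qed

lemma sum_principal_minors_CARD: "sum_principal_minors CARD('n) (A :: real ^ 'n ^ 'n) = det A"
proof -
  have "{I :: 'n set. card I = CARD('n)} = {UNIV}"
    using card_subset_eq[of "UNIV :: 'n set"] by auto
  then show ?thesis
    by (simp add: sum_principal_minors_def principal_minor_UNIV)
qed

definition gradient :: "(real ^ 'n \<Rightarrow> real) \<Rightarrow> real ^ 'n \<Rightarrow> real ^ 'n" where
  "gradient u x = (\<chi> i. frechet_derivative u (at x) (axis i 1))"

definition hessian :: "(real ^ 'n \<Rightarrow> real) \<Rightarrow> real ^ 'n \<Rightarrow> real ^ 'n ^ 'n" where
  "hessian u x = jacobian (gradient u) (at x)"

definition hessian_operator :: "nat \<Rightarrow> (real ^ 'n \<Rightarrow> real) \<Rightarrow> real ^ 'n \<Rightarrow> real" where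
  "hessian_operator k u x = sum_principal_minors k (hessian u x)"

definition C2_space :: "(real ^ 'n \<Rightarrow> real) \<Rightarrow> bool" where
  "C2_space u \<longleftrightarrow> u differentiable_on UNIV \<and> gradient u differentiable_on UNIV
     \<and> continuous_on UNIV (hessian u)"

(* Derivatives at the endpoint 0 are one-sided. *)
definition C2_halfline :: "(real \<Rightarrow> real) \<Rightarrow> bool" where
  "C2_halfline u \<longleftrightarrow> (\<exists>u' u''.
     (\<forall>r\<ge>0. (u has_real_derivative u' r) (at r within {0..})) \<and>
     (\<forall>r\<ge>0. (u' has_real_derivative u'' r) (at r within {0..})) \<and>
     continuous_on {0..} u'')"

definition radial :: "(real \<Rightarrow> real) \<Rightarrow> real ^ 'n \<Rightarrow> real" where
  "radial u x = u (norm x)"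

(* In the following N is the dimension, k the order of the Hessian operator, and b, p are the
   coefficients of one equation; C_const is C_0 for k = k_1 and C_00 for k = k_2. *)
definition C_const :: "nat \<Rightarrow> nat \<Rightarrow> real" where
  "C_const N k = fact (N - 1) / (fact k * fact (N - k))"

definition B_minus :: "nat \<Rightarrow> nat \<Rightarrow> (real \<Rightarrow> real) \<Rightarrow> real \<Rightarrow> real" where
  "B_minus N k b \<xi> = \<xi> powi (int k - int N) / C_const N k
     * exp (- integral {0..\<xi>} (\<lambda>t. 1 / C_const N k * t ^ (k - 1) * b t))"

definition B_plus :: "nat \<Rightarrow> nat \<Rightarrow> (real \<Rightarrow> real) \<Rightarrow> (real \<Rightarrow> real) \<Rightarrow> real \<Rightarrow> real" where
  "B_plus N k b p \<xi> = \<xi> ^ (N - 1)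
     * exp (integral {0..\<xi>} (\<lambda>t. 1 / C_const N k * t ^ (k - 1) * b t)) * p \<xi>"

definition P_fun :: "nat \<Rightarrow> nat \<Rightarrow> (real \<Rightarrow> real) \<Rightarrow> (real \<Rightarrow> real) \<Rightarrow> real \<Rightarrow> real" where
  "P_fun N k b p r =
     integral {0..r} (\<lambda>y. (B_minus N k b y * integral {0..y} (B_plus N k b p)) powr (1 / real k))"

(* The parameter a is a_1 + a_2. *)
definition F_fun ::
  "nat \<Rightarrow> nat \<Rightarrow> (real \<Rightarrow> real \<Rightarrow> real) \<Rightarrow> (real \<Rightarrow> real \<Rightarrow> real) \<Rightarrow> real \<Rightarrow> real \<Rightarrow> real" where
  "F_fun k1 k2 f1 f2 a r =
     integral {a..r} (\<lambda>t. 1 / (f1 t t powr (1 / real k1) + f2 t t powr (1 / real k2)))"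

definition F_inv ::
  "nat \<Rightarrow> nat \<Rightarrow> (real \<Rightarrow> real \<Rightarrow> real) \<Rightarrow> (real \<Rightarrow> real \<Rightarrow> real) \<Rightarrow> real \<Rightarrow> real \<Rightarrow> real" where
  "F_inv k1 k2 f1 f2 a = the_inv_into {a..} (F_fun k1 k2 f1 f2 a)"

definition at_infty :: "(real \<Rightarrow> real) \<Rightarrow> ereal" where
  "at_infty g = Lim at_top (\<lambda>r. ereal (g r))"

definition nonneg_continuous :: "(real \<Rightarrow> real) \<Rightarrow> bool" where
  "nonneg_continuous g \<longleftrightarrow> continuous_on {0..} g \<and> (\<forall>r\<ge>0. 0 \<le> g r)"

definition admissible_nonlinearity :: "(real \<Rightarrow> real \<Rightarrow> real) \<Rightarrow> bool" where
  "admissible_nonlinearity f \<longleftrightarrow>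
     continuous_on ({0..} \<times> {0..}) (\<lambda>(s, t). f s t) \<and>
     (\<forall>s\<ge>0. \<forall>t\<ge>0. 0 \<le> f s t) \<and>
     (\<forall>t\<ge>0. strict_mono_on {0..} (\<lambda>s. f s t)) \<and>
     (\<forall>s\<ge>0. strict_mono_on {0..} (\<lambda>t. f s t))"

(* If k > 1, p = 0 on [0,\<rho>] and p(r) = r - \<rho> to the right of \<rho>, then a solution has |u'(r)|
   of order (r - \<rho>) powr (2/k) there, and so u is not C^2. A C^2 solution u exists only if
   P_fun N k b p is C^2. This is the case whenever k = 1 or p 0 > 0; the third alternative makes
   the condition necessary as well as sufficient. *)
definition C2_compatible ::
  "nat \<Rightarrow> nat \<Rightarrow> (real \<Rightarrow> real) \<Rightarrow> (real \<Rightarrow> real) \<Rightarrow> bool" where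
  "C2_compatible N k b p \<longleftrightarrow> k = 1 \<or> 0 < p 0 \<or> C2_halfline (P_fun N k b p)"

end

theory Submission
  imports Defs
begin

text \<open>
  The Hessian of a radial function is a multiple of the identity plus a rank-one matrix, so the
  system reduces to \<open>C\<^sub>0 r\<^bsup>1-N\<^esup> (r\<^bsup>N-k\<^esup> u'\<^sup>k)' + b u'\<^sup>k = p f\<close>. An integrating factor turns this into the
  integral equation \<open>u' = (B\<^sup>- \<integral> B\<^sup>+ f(u\<^sub>1, u\<^sub>2))\<^bsup>1/k\<^esup>\<close>. The Picard iterates starting from the constants
  \<open>(a\<^sub>1, a\<^sub>2)\<close> increase, because \<open>f\<^sub>1\<close> and \<open>f\<^sub>2\<close> do, and the sum \<open>S\<close> of the two components
  satisfies \<open>(F \<circ> S)' \<le> P\<^sub>1' + P\<^sub>2'\<close>; since \<open>P\<^sub>1(\<infinity>) + P\<^sub>2(\<infinity>) < F(\<infinity>)\<close>, they are bounded uniformly, and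
  dominated convergence gives a solution of the integral equation. For its \<open>C\<^sup>2\<close> regularity only the
  zeros of \<open>u'/r\<close> matter: there \<open>u'\<close> and \<open>u''\<close> are compared with \<open>P'\<close> and \<open>P''\<close>.
\<close>

text \<open>For \<open>k > 1\<close> the equation degenerates where \<open>u'/r\<close> vanishes:
  the k-th root is not differentiable at 0, so integrating once does not yield a C^2 function there.
  The remedy is that the source \<open>g = f(u1, u2)\<close> is nondecreasing in \<open>r\<close>
  and positive at 0, hence lies between positive constants on every bounded interval. So
  \<open>u'\<close> and \<open>P'\<close> are comparable and vanish at the same radii, and the
  smoothness of \<open>P\<close> supplied by \<open>C2_compatible\<close> in this case carries over
  to \<open>u\<close>. The origin is a second singular point; it is removed by working with the
  continuous quotient \<open>Z = u'/r\<close>.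

  In the a priori bound the diagonal values \<open>f_i(t, t)\<close> of \<open>F\<close> arise
  because each of the two nonnegative components is at most their sum. The gap between the limits at
  infinity yields one number \<open>B\<close> with \<open>P1 + P2 <= F B\<close> everywhere. It
  bounds all iterates, it bounds all sources by \<open>f_i(B, B)\<close>, and it places
  \<open>P1 r + P2 r\<close> in the range of \<open>F\<close>. A pointwise increasing limit need not
  be continuous; here continuity comes from the integral equation.\<close>

section \<open>Principal minors of rank-one perturbations of scalar matrices\<close>

text \<open>Composition with a transposition of two elements of \<open>J\<close> permutes the
  summands and flips every sign, so the sum is its own negative. It is the determinant of an
  all-ones matrix.\<close>

lemma sum_sign_permutes:
  assumes "finite J" "2 \<le> card J"
  shows "(\<Sum>\<pi> | \<pi> permutes J. of_int (sign \<pi>)) = (0::real)"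
proof -
  obtain a b where ab: "a \<in> J" "b \<in> J" "a \<noteq> b"
    using assms by (metis card_2_iff' obtain_subset_with_card_n subsetD)
  define \<tau> where "\<tau> = Transposition.transpose a b"
  have \<tau>: "\<tau> permutes J"
    using ab unfolding \<tau>_def by (simp add: permutes_swap_id)
  have sgn: "of_int (sign (\<tau> \<circ> \<pi>)) = - (of_int (sign \<pi>) :: real)" if "\<pi> permutes J" for \<pi>
  proof -
    have "permutation \<tau>" "permutation \<pi>"
      using \<tau> that assms(1) permutation_permutes by blast+
    then show ?thesis using ab by (simp add: sign_compose \<tau>_def sign_swap_id)
  qed
  have "(\<Sum>\<pi> | \<pi> permutes J. of_int (sign \<pi>)) = (\<Sum>\<pi> | \<pi> permutes J. of_int (sign (\<tau> \<circ> \<pi>)) :: real)"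
    by (rule setum_permutations_compose_left[OF \<tau>])
  also have "\<dots> = - (\<Sum>\<pi> | \<pi> permutes J. of_int (sign \<pi>))"
    by (simp add: sgn sum_negf)
  finally show ?thesis by simp
qed

lemma sum_subsets_card_le_1:
  fixes g :: "'a set \<Rightarrow> real"
  assumes "finite I" "\<And>J. J \<subseteq> I \<Longrightarrow> 2 \<le> card J \<Longrightarrow> g J = 0"
  shows "(\<Sum>J\<in>Pow I. g J) = g {} + (\<Sum>i\<in>I. g {i})"
proof -
  have "(\<Sum>J\<in>Pow I. g J) = (\<Sum>J\<in>insert {} ((\<lambda>i. {i}) ` I). g J)"
  proof (rule sum.mono_neutral_right)
    show "\<forall>J\<in>Pow I - insert {} ((\<lambda>i. {i}) ` I). g J = 0"
    proof
      fix J assume J: "J \<in> Pow I - insert {} ((\<lambda>i. {i}) ` I)"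
      then have fin: "finite J" using assms(1) finite_subset by blast
      have "card J \<noteq> 0" using J fin by auto
      moreover have "card J \<noteq> 1" using J by (auto simp: card_1_singleton_iff)
      ultimately show "g J = 0" using assms(2) J by auto
    qed
  qed (use assms in auto)
  also have "\<dots> = g {} + (\<Sum>i\<in>I. g {i})"
    by (subst sum.insert) (use assms in \<open>auto simp: sum.reindex\<close>)
  finally show ?thesis .
qed

text \<open>Expand the product over \<open>I\<close> by the set \<open>J\<close> of rows that
  contribute their rank-one entry. The other rows force \<open>\<pi>\<close> to fix
  \<open>I - J\<close>, so \<open>\<pi>\<close> permutes \<open>J\<close>; reindexing makes the
  rank-one product independent of \<open>\<pi>\<close>. Only signs remain to be summed, and they
  cancel unless \<open>J\<close> has at most one element.\<close>

lemma principal_minor_rank_one: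
  fixes x :: "real ^ 'n" and z c :: real
  shows "principal_minor (\<chi> i j. c * (x $ i * x $ j) + (if i = j then z else 0)) I
    = z ^ card I + c * z ^ (card I - 1) * (\<Sum>i\<in>I. (x $ i)\<^sup>2)"
proof -
  let ?S = "\<lambda>J. (\<Sum>\<pi> | \<pi> permutes J. of_int (sign \<pi>)) :: real"
  let ?t = "\<lambda>\<pi> J. (\<Prod>i\<in>J. c * (x $ i * x $ \<pi> i)) * (\<Prod>i\<in>I - J. if i = \<pi> i then z else 0)"
  define g where "g J = z ^ card (I - J) * c ^ card J * (\<Prod>i\<in>J. x $ i)\<^sup>2 * ?S J" for J
  have inner: "(\<Sum>\<pi> | \<pi> permutes I. of_int (sign \<pi>) * ?t \<pi> J) = g J" if J: "J \<subseteq> I" for J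
  proof -
    have "(\<Sum>\<pi> | \<pi> permutes I. of_int (sign \<pi>) * ?t \<pi> J)
        = (\<Sum>\<pi> | \<pi> permutes J. of_int (sign \<pi>) * ?t \<pi> J)"
    proof (rule sum.mono_neutral_right)
      show "{\<pi>. \<pi> permutes J} \<subseteq> {\<pi>. \<pi> permutes I}" using J permutes_subset by blast
      show "\<forall>\<pi>\<in>{\<pi>. \<pi> permutes I} - {\<pi>. \<pi> permutes J}. of_int (sign \<pi>) * ?t \<pi> J = 0"
      proof
        fix \<pi> assume \<pi>: "\<pi> \<in> {\<pi>. \<pi> permutes I} - {\<pi>. \<pi> permutes J}"
        then obtain i where i: "i \<in> I - J" "\<pi> i \<noteq> i"
          using permutes_superset by blast
        have "(\<Prod>i\<in>I - J. if i = \<pi> i then z else 0) = 0"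
          by (rule prod_zero) (use i in \<open>auto intro!: bexI[of _ i]\<close>)
        then show "of_int (sign \<pi>) * ?t \<pi> J = 0" by simp
      qed
    qed (simp add: finite_permutations)
    also have "\<dots> = (\<Sum>\<pi> | \<pi> permutes J. of_int (sign \<pi>) * (z ^ card (I - J) * c ^ card J * (\<Prod>i\<in>J. x $ i)\<^sup>2))"
    proof (rule sum.cong[OF refl])
      fix \<pi> assume "\<pi> \<in> {\<pi>. \<pi> permutes J}"
      then have \<pi>: "\<pi> permutes J" by simp
      have 1: "(\<Prod>i\<in>I - J. if i = \<pi> i then z else 0) = (\<Prod>i\<in>I - J. z)"
        by (rule prod.cong) (use \<pi> permutes_not_in in \<open>auto, fastforce\<close>)
      have 2: "(\<Prod>i\<in>J. x $ \<pi> i) = (\<Prod>i\<in>J. x $ i)"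
        using prod.permute[OF \<pi>, of "\<lambda>i. x $ i"] by (simp add: o_def)
      show "of_int (sign \<pi>) * ?t \<pi> J
          = of_int (sign \<pi>) * (z ^ card (I - J) * c ^ card J * (\<Prod>i\<in>J. x $ i)\<^sup>2)"
        unfolding 1 by (simp add: prod.distrib 2 power2_eq_square)
    qed
    also have "\<dots> = g J"
      by (simp add: g_def sum_distrib_left mult_ac)
    finally show ?thesis .
  qed
  have "principal_minor (\<chi> i j. c * (x $ i * x $ j) + (if i = j then z else 0)) I
    = (\<Sum>\<pi> | \<pi> permutes I. of_int (sign \<pi>) * (\<Sum>J\<in>Pow I. ?t \<pi> J))"
    unfolding principal_minor_def by (simp add: prod_add)
  also have "\<dots> = (\<Sum>J\<in>Pow I. \<Sum>\<pi> | \<pi> permutes I. of_int (sign \<pi>) * ?t \<pi> J)"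
    unfolding sum_distrib_left by (rule sum.swap)
  also have "\<dots> = (\<Sum>J\<in>Pow I. g J)"
    by (rule sum.cong) (use inner in auto)
  also have "\<dots> = g {} + (\<Sum>i\<in>I. g {i})"
    by (rule sum_subsets_card_le_1) (auto simp: g_def sum_sign_permutes)
  also have "g {} = z ^ card I" by (simp add: g_def)
  also have "(\<Sum>i\<in>I. g {i}) = (\<Sum>i\<in>I. c * z ^ (card I - 1) * (x $ i)\<^sup>2)"
    by (rule sum.cong) (auto simp: g_def mult_ac)
  finally show ?thesis by (simp add: sum_distrib_left)
qed

lemma card_subsets_containing:
  assumes "finite A" "i \<in> A" "1 \<le> k"
  shows "card {I. I \<subseteq> A \<and> card I = k \<and> i \<in> I} = (card A - 1) choose (k - 1)"
proof -
  have "bij_betw (\<lambda>J. insert i J) {J. J \<subseteq> A - {i} \<and> card J = k - 1} {I. I \<subseteq> A \<and> card I = k \<and> i \<in> I}"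
  proof (rule bij_betw_byWitness[where f' = "\<lambda>I. I - {i}"])
    show "insert i ` {J. J \<subseteq> A - {i} \<and> card J = k - 1} \<subseteq> {I. I \<subseteq> A \<and> card I = k \<and> i \<in> I}"
    proof
      fix I assume "I \<in> insert i ` {J. J \<subseteq> A - {i} \<and> card J = k - 1}"
      then obtain J where J: "I = insert i J" "J \<subseteq> A - {i}" "card J = k - 1" by blast
      then have "finite J" "i \<notin> J" using assms(1) by (auto intro: finite_subset)
      then show "I \<in> {I. I \<subseteq> A \<and> card I = k \<and> i \<in> I}" using J assms by auto
    qed
    show "(\<lambda>I. I - {i}) ` {I. I \<subseteq> A \<and> card I = k \<and> i \<in> I} \<subseteq> {J. J \<subseteq> A - {i} \<and> card J = k - 1}"
      using assms by (auto simp: card_Diff_singleton)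
  qed auto
  from bij_betw_same_card[OF this] show ?thesis
    using n_subsets[of "A - {i}" "k - 1"] assms by simp
qed

text \<open>Double counting: each \<open>(x $ i)\<^sup>2\<close> occurs once for every index set of
  size \<open>k\<close> that contains \<open>i\<close>.\<close>

lemma sum_principal_minors_rank_one:
  fixes x :: "real ^ 'n" and z c :: real
  assumes "1 \<le> k"
  shows "sum_principal_minors k (\<chi> i j. c * (x $ i * x $ j) + (if i = j then z else 0))
    = of_nat (CARD('n) choose k) * z ^ k
      + of_nat ((CARD('n) - 1) choose (k - 1)) * c * z ^ (k - 1) * (norm x)\<^sup>2"
proof -
  let ?K = "{I :: 'n set. card I = k}"
  have "(\<Sum>I\<in>?K. \<Sum>i\<in>I. (x $ i)\<^sup>2) = (\<Sum>I\<in>?K. \<Sum>i\<in>UNIV. if i \<in> I then (x $ i)\<^sup>2 else 0)"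
    by (simp add: sum.If_cases)
  also have "\<dots> = (\<Sum>i\<in>UNIV. \<Sum>I\<in>?K. if i \<in> I then (x $ i)\<^sup>2 else 0)"
    by (rule sum.swap)
  also have "\<dots> = (\<Sum>i\<in>UNIV. real (card {I :: 'n set. I \<subseteq> UNIV \<and> card I = k \<and> i \<in> I}) * (x $ i)\<^sup>2)"
    by (rule sum.cong) (auto simp: sum.If_cases Int_def)
  also have "\<dots> = (\<Sum>i\<in>UNIV. of_nat ((CARD('n) - 1) choose (k - 1)) * (x $ i)\<^sup>2)"
    by (subst card_subsets_containing) (use assms in auto)
  also have "\<dots> = of_nat ((CARD('n) - 1) choose (k - 1)) * (norm x)\<^sup>2"
    by (simp add: norm_vec_def L2_set_def sum_nonneg flip: sum_distrib_left)
  finally have sq: "(\<Sum>I\<in>?K. \<Sum>i\<in>I. (x $ i)\<^sup>2)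
    = of_nat ((CARD('n) - 1) choose (k - 1)) * (norm x)\<^sup>2" .
  have "card ?K = CARD('n) choose k"
    using n_subsets[of "UNIV :: 'n set" k] by simp
  then show ?thesis
    unfolding sum_principal_minors_def principal_minor_rank_one
    by (simp add: sum.distrib sq flip: sum_distrib_left)
qed

section \<open>Hessians of radial functions\<close>

text \<open>Here \<open>z\<close> is \<open>u'/r\<close> and \<open>\<psi>\<close> is
  \<open>u''\<close>. Taking \<open>z\<close> as data, continuous up to 0, makes the gradient
  \<open>z (norm x) *\<^sub>R x\<close> regular at the origin; \<open>\<psi>_0\<close> makes the
  Hessian tend to a multiple of the identity there.\<close>

locale radial_profile =
  fixes u z \<psi> :: "real \<Rightarrow> real"
  assumes u_deriv: "0 \<le> r \<Longrightarrow> (u has_real_derivative r * z r) (at r within {0..})"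
    and v_deriv: "0 \<le> r \<Longrightarrow> ((\<lambda>r. r * z r) has_real_derivative \<psi> r) (at r within {0..})"
    and z_cont: "continuous_on {0..} z"
    and \<psi>_cont: "continuous_on {0..} \<psi>"
    and \<psi>_0: "\<psi> 0 = z 0"
begin

lemma C2_halfline: "C2_halfline u"
  unfolding C2_halfline_def
  by (intro exI[of _ "\<lambda>r. r * z r"] exI[of _ \<psi>]) (simp add: u_deriv v_deriv \<psi>_cont)

lemma at_within_pos: "0 < r \<Longrightarrow> at r within {0..} = at (r::real)"
  by (rule at_within_interior) simp

lemma continuous_on_radial: "continuous_on {0..} g \<Longrightarrow> continuous_on UNIV (radial g)"
  unfolding radial_def by (erule continuous_on_compose2) (simp_all add: continuous_on_norm_id image_subset_iff)

lemma radial_has_derivative: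
  fixes x :: "real ^ 'n"
  shows "(radial u has_derivative (\<lambda>h. z (norm x) * (x \<bullet> h))) (at x)"
proof (cases "x = 0")
  case False
  then have r: "0 < norm x" by simp
  have "(u has_derivative (\<lambda>h. h * (norm x * z (norm x)))) (at (norm x))"
    using u_deriv[of "norm x"] r by (simp add: at_within_pos has_field_derivative_def mult_commute_abs)
  from has_derivative_compose[OF has_derivative_norm[OF False] this]
  show ?thesis
    unfolding radial_def by (rule has_derivative_eq_rhs) (use r in \<open>simp add: sgn_div_norm fun_eq_iff inner_commute[of _ x]\<close>)
next
  case True
  \<comment> \<open>The norm is not differentiable at the origin, so the difference quotient
    replaces the chain rule; its limit is \<open>u' 0 = 0 * z 0 = 0\<close>.\<close>
  have lim: "((\<lambda>y. (u y - u 0) / y) \<longlongrightarrow> 0) (at 0 within {0..})"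
    using u_deriv[of 0] by (simp add: has_field_derivative_iff)
  have "((\<lambda>y :: real^'n. (u (norm y) - u 0) / norm y) \<longlongrightarrow> 0) (at 0)"
  proof (rule filterlim_compose[OF lim])
    show "filterlim (norm :: real ^ 'n \<Rightarrow> real) (at 0 within {0..}) (at 0)"
      unfolding filterlim_at
      by (simp add: eventually_at_filter tendsto_norm_zero)
  qed
  from tendsto_norm_zero[OF this] show ?thesis
    unfolding has_derivative_at radial_def by (simp add: True)
qed

lemma radial_gradient: "gradient (radial u) = (\<lambda>x :: real ^ 'n. z (norm x) *\<^sub>R x)"
proof
  fix x :: "real ^ 'n"
  have "frechet_derivative (radial u) (at x) = (\<lambda>h. z (norm x) * (x \<bullet> h))"
    by (rule frechet_derivative_at[OF radial_has_derivative, symmetric])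
  then show "gradient (radial u) x = z (norm x) *\<^sub>R x"
    by (simp add: gradient_def vec_eq_iff inner_axis)
qed

text \<open>At \<open>x = 0\<close> the coefficient \<open>(\<psi> - z) / |x|\<^sup>2\<close> is \<open>0\<close> by the convention on division.\<close>

lemma gradient_has_derivative:
  fixes x :: "real ^ 'n"
  shows "((\<lambda>x :: real ^ 'n. z (norm x) *\<^sub>R x) has_derivative
    (\<lambda>h. z (norm x) *\<^sub>R h + ((\<psi> (norm x) - z (norm x)) / (norm x)\<^sup>2 * (x \<bullet> h)) *\<^sub>R x)) (at x)"
proof (cases "x = 0")
  case False
  then have r: "0 < norm x" by simp
  let ?r = "norm x"
  \<comment> \<open>Off the origin, differentiability of \<open>z\<close> is recovered from that of
    \<open>r * z r\<close> by division.\<close>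
  have "((\<lambda>r. (r * z r) / r) has_real_derivative (\<psi> ?r * ?r - ?r * z ?r * 1) / (?r * ?r)) (at ?r)"
    by (rule DERIV_divide) (use v_deriv[of ?r] r in \<open>auto simp: at_within_pos\<close>)
  then have "(z has_real_derivative (\<psi> ?r * ?r - ?r * z ?r * 1) / (?r * ?r)) (at ?r)"
    by (rule has_field_derivative_transform_within_open[of _ _ _ "{0<..}"]) (use r in auto)
  then have "(z has_real_derivative (\<psi> ?r - z ?r) / ?r) (at ?r)"
    by (rule DERIV_cong) (use r in \<open>simp add: field_simps\<close>)
  then have "(z has_derivative (*) ((\<psi> ?r - z ?r) / ?r)) (at ?r)"
    by (simp add: has_field_derivative_def)
  from has_derivative_compose[OF has_derivative_norm[OF False] this]
  have "((\<lambda>x :: real ^ 'n. z (norm x)) has_derivative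
      (\<lambda>h. (\<psi> ?r - z ?r) / ?r * (sgn x \<bullet> h))) (at x)"
    by (simp add: inner_commute)
  from has_derivative_scaleR[OF this has_derivative_ident]
  show ?thesis
    by (rule has_derivative_eq_rhs)
       (simp add: fun_eq_iff sgn_div_norm power2_eq_square divide_inverse)
next
  case True
  have lim: "((\<lambda>x :: real^'n. z (norm x)) \<longlongrightarrow> z 0) (at 0)"
    using continuous_on_radial[OF z_cont, where ?'a = 'n]
    by (simp add: radial_def continuous_on_eq_continuous_at isCont_def) (metis norm_zero)
  have "((\<lambda>y :: real^'n. \<bar>z (norm y) - z 0\<bar>) \<longlongrightarrow> 0) (at 0)"
    using tendsto_rabs_zero[OF LIM_zero[OF lim]] .
  \<comment> \<open>The remainder quotient equals \<open>\<bar>z (norm y) - z 0\<bar>\<close>, so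
    continuity of \<open>z\<close> at 0 decides.\<close>
  moreover have "norm (z (norm y) *\<^sub>R y - z 0 *\<^sub>R y) / norm y = \<bar>z (norm y) - z 0\<bar>" if "y \<noteq> 0" for y :: "real^'n"
    using that by (simp flip: scaleR_diff_left)
  ultimately have "((\<lambda>y :: real^'n. norm (z (norm y) *\<^sub>R y - z 0 *\<^sub>R y) / norm y) \<longlongrightarrow> 0) (at 0)"
    by (elim Lim_transform_eventually) (simp add: eventually_at_filter)
  then show ?thesis
    using True by (simp add: has_derivative_at bounded_linear_scaleR_right)
qed

lemma radial_hessian:
  fixes x :: "real ^ 'n"
  shows "hessian (radial u) x = (\<chi> i j. (\<psi> (norm x) - z (norm x)) / (norm x)\<^sup>2 * (x $ i * x $ j)
    + (if i = j then z (norm x) else 0))"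
proof -
  have "frechet_derivative (gradient (radial u)) (at x) = (\<lambda>h. z (norm x) *\<^sub>R h
     + ((\<psi> (norm x) - z (norm x)) / (norm x)\<^sup>2 * (x \<bullet> h)) *\<^sub>R x)"
    unfolding radial_gradient by (rule frechet_derivative_at[OF gradient_has_derivative, symmetric])
  then show ?thesis
    unfolding hessian_def jacobian_def matrix_def by (simp add: vec_eq_iff inner_axis) (simp add: axis_def)
qed

lemma C2_space_radial: "C2_space (radial u :: real ^ 'n \<Rightarrow> real)"
  unfolding C2_space_def
proof (intro conjI)
  show "radial u differentiable_on (UNIV :: (real ^ 'n) set)"
    using radial_has_derivative by (auto simp: differentiable_on_def differentiable_def)
  show "gradient (radial u) differentiable_on (UNIV :: (real ^ 'n) set)"
    unfolding radial_gradient using gradient_has_derivative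
    by (auto simp: differentiable_on_def differentiable_def)
  have z: "continuous_on UNIV (\<lambda>x :: real ^ 'n. z (norm x))"
    using continuous_on_radial[OF z_cont] by (simp add: radial_def)
  have \<psi>: "continuous_on UNIV (\<lambda>x :: real ^ 'n. \<psi> (norm x))"
    using continuous_on_radial[OF \<psi>_cont] by (simp add: radial_def)
  have zc: "isCont (\<lambda>x :: real ^ 'n. z (norm x)) x" and \<psi>c: "isCont (\<lambda>x :: real ^ 'n. \<psi> (norm x)) x" for x
    using z \<psi> by (auto simp: continuous_on_eq_continuous_at)
  have c: "isCont (\<lambda>x :: real ^ 'n. (\<psi> (norm x) - z (norm x)) / (norm x)\<^sup>2 * (x $ i * x $ j)) x" for i j x
  proof (cases "x = 0")
    case False
    then show ?thesis
      by (intro continuous_intros zc \<psi>c) simp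
  next
    case True
    have "isCont (\<lambda>x :: real ^ 'n. \<psi> (norm x) - z (norm x)) 0"
      by (intro continuous_intros zc \<psi>c)
    then have lim: "((\<lambda>x :: real ^ 'n. \<bar>\<psi> (norm x) - z (norm x)\<bar>) \<longlongrightarrow> 0) (at 0)"
      using \<psi>_0 by (auto simp: isCont_def intro: tendsto_rabs_zero)
    \<comment> \<open>The division by \<open>(norm x)\<^sup>2\<close> is compensated by
      \<open>x $ i * x $ j\<close>, and what remains tends to
      \<open>\<psi> 0 - z 0 = 0\<close>.\<close>
    have "((\<lambda>x :: real ^ 'n. (\<psi> (norm x) - z (norm x)) / (norm x)\<^sup>2 * (x $ i * x $ j)) \<longlongrightarrow> 0) (at 0)"
    proof (rule Lim_null_comparison[OF _ lim], rule always_eventually, rule allI)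
      fix x :: "real ^ 'n"
      have "\<bar>x $ i * x $ j\<bar> \<le> norm x * norm x"
        unfolding abs_mult by (intro mult_mono component_le_norm_cart) auto
      then have "\<bar>x $ i * x $ j\<bar> / (norm x)\<^sup>2 \<le> 1"
        by (cases "x = 0") (auto simp: power2_eq_square divide_simps)
      then have "\<bar>\<psi> (norm x) - z (norm x)\<bar> * (\<bar>x $ i * x $ j\<bar> / (norm x)\<^sup>2) \<le> \<bar>\<psi> (norm x) - z (norm x)\<bar> * 1"
        by (intro mult_left_mono) auto
      then show "norm ((\<psi> (norm x) - z (norm x)) / (norm x)\<^sup>2 * (x $ i * x $ j)) \<le> \<bar>\<psi> (norm x) - z (norm x)\<bar>"
        by (simp add: abs_mult)
    qed
    then show ?thesis using True by (simp add: isCont_def)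
  qed
  show "continuous_on UNIV (hessian (radial u) :: real ^ 'n \<Rightarrow> _)"
    unfolding radial_hessian
  proof (intro continuous_on_vec_lambda continuous_on_add)
    fix i j :: 'n
    show "continuous_on UNIV (\<lambda>x :: real ^ 'n. (\<psi> (norm x) - z (norm x)) / (norm x)\<^sup>2 * (x $ i * x $ j))"
      using c by (simp add: continuous_on_eq_continuous_at)
    show "continuous_on UNIV (\<lambda>x :: real ^ 'n. if i = j then z (norm x) else 0)"
      using z by (cases "i = j") auto
  qed
qed

text \<open>The eigenvalues are \<open>\<psi>\<close> once and \<open>z\<close> with multiplicity
  \<open>CARD('n) - 1\<close>. In the rank-one formula, Pascal's rule splits the coefficient of
  \<open>z ^ k\<close> so that one part cancels against the rank-one term.\<close>

lemma radial_hessian_operator: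
  fixes x :: "real ^ 'n"
  assumes "1 \<le> k"
  shows "hessian_operator k (radial u) x =
    of_nat ((CARD('n) - 1) choose k) * z (norm x) ^ k
    + of_nat ((CARD('n) - 1) choose (k - 1)) * z (norm x) ^ (k - 1) * \<psi> (norm x)"
proof -
  \<comment> \<open>At \<open>x = 0\<close> the left side is 0 and so is the right side, by
    \<open>\<psi>_0\<close>.\<close>
  have rank: "(\<psi> (norm x) - z (norm x)) / (norm x)\<^sup>2 * (norm x)\<^sup>2 = \<psi> (norm x) - z (norm x)"
    using \<psi>_0 by (cases "x = 0") auto
  obtain n where n: "CARD('n) = Suc n" using zero_less_card_finite gr0_implies_Suc by blast
  obtain l where l: "k = Suc l" using assms by (cases k) auto
  have "hessian_operator k (radial u) x = of_nat (CARD('n) choose k) * z (norm x) ^ k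
      + of_nat ((CARD('n) - 1) choose (k - 1)) * z (norm x) ^ (k - 1)
        * ((\<psi> (norm x) - z (norm x)) / (norm x)\<^sup>2 * (norm x)\<^sup>2)"
    unfolding hessian_operator_def radial_hessian sum_principal_minors_rank_one[OF assms]
    by (simp only: mult.assoc mult.left_commute[of _ "z (norm x) ^ (k - 1)"])
  also have "\<dots> = of_nat (CARD('n) choose k) * z (norm x) ^ k
      + of_nat ((CARD('n) - 1) choose (k - 1)) * z (norm x) ^ (k - 1) * (\<psi> (norm x) - z (norm x))"
    unfolding rank by (rule refl)
  also have "real (CARD('n) choose k) = real ((CARD('n) - 1) choose k) + real ((CARD('n) - 1) choose (k - 1))"
    by (simp add: n l)
  also have "z (norm x) ^ k = z (norm x) * z (norm x) ^ (k - 1)"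
    by (simp add: l)
  finally show ?thesis by (simp add: algebra_simps l)
qed

end

section \<open>The radial integral equation\<close>

lemma integral_has_real_derivative_halfline:
  fixes g :: "real \<Rightarrow> real"
  assumes "continuous_on {a..} g" "a \<le> t"
  shows "((\<lambda>x. integral {a..x} g) has_real_derivative g t) (at t within {a..})"
proof -
  have "((\<lambda>x. integral {a..x} g) has_real_derivative g t) (at t within {a..t + 1})"
    by (rule integral_has_real_derivative) (use assms in \<open>auto intro: continuous_on_subset\<close>)
  moreover have "at t within {a..t + 1} = at t within {a..}"
    by (rule at_within_nhd[of _ "{..<t + 1}"]) auto
  ultimately show ?thesis by simp
qed

lemma has_real_derivative_continuous_on:
  assumes "\<And>x. x \<in> S \<Longrightarrow> (f has_real_derivative f' x) (at x within S)"
  shows "continuous_on S f"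
  using assms by (meson continuous_on_eq_continuous_within has_field_derivative_imp_has_derivative
      has_derivative_continuous)

text \<open>The difference quotients from the right determine the limit, at the endpoint
  \<open>a\<close> as well.\<close>

lemma has_real_derivative_unique_halfline:
  assumes "(f has_real_derivative d) (at r within {a..})" "(f has_real_derivative e) (at r within {a..})" "a \<le> r"
  shows "d = e"
proof -
  have "{r<..} \<subseteq> {a..}" using assms(3) by auto
  with assms(1,2) have "((\<lambda>y. (f y - f r) / (y - r)) \<longlongrightarrow> d) (at_right r)"
    "((\<lambda>y. (f y - f r) / (y - r)) \<longlongrightarrow> e) (at_right r)"
    unfolding has_field_derivative_iff by (blast intro: tendsto_within_subset)+
  then show ?thesis by (rule tendsto_unique[OF trivial_limit_at_right_real])
qed

text \<open>Monotonicity and positivity at 0 give \<open>0 < g 0 \<le> g s \<le> g r\<close> for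
  \<open>0 \<le> s \<le> r\<close>, the two-sided control on which every comparison with the
  constant source 1, that is with \<open>P\<close>, rests.\<close>

definition regular_source :: "(real \<Rightarrow> real) \<Rightarrow> bool" where
  "regular_source g \<longleftrightarrow> continuous_on {0..} g \<and> mono_on {0..} g \<and> 0 < g 0"

lemma regular_source_1: "regular_source (\<lambda>_. 1)"
  by (auto simp: regular_source_def mono_on_def)

lemma continuous_on_halflineI:
  fixes f :: "real \<Rightarrow> 'a :: topological_space"
  assumes "\<And>b. a \<le> b \<Longrightarrow> continuous_on {a..b} f"
  shows "continuous_on {a..} f"
  unfolding continuous_on_eq_continuous_within
proof
  fix r assume r: "r \<in> {a..}"
  have "at r within {a..r + 1} = at r within {a..}"
    by (rule at_within_nhd[of _ "{..<r + 1}"]) auto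
  then show "continuous (at r within {a..}) f"
    using assms[of "r + 1", unfolded continuous_on_def, THEN bspec, of r] r
    by (simp add: continuous_within)
qed

locale radial_equation =
  fixes N k :: nat and b p :: "real \<Rightarrow> real"
  assumes k: "1 \<le> k" "k \<le> N" and b: "nonneg_continuous b" and p: "nonneg_continuous p"
begin

abbreviation "C \<equiv> C_const N k"

lemma C_pos: "0 < C"
  by (simp add: C_const_def)

lemma N_pos: "0 < N"
  using k by simp

lemma b_cont: "continuous_on {0..} b"
  and p_cont: "continuous_on {0..} p" and p_nonneg: "0 \<le> r \<Longrightarrow> 0 \<le> p r"
  using b p by (auto simp: nonneg_continuous_def)

definition E :: "real \<Rightarrow> real" where
  "E r = integral {0..r} (\<lambda>t. 1 / C * t ^ (k - 1) * b t)"

lemma E_deriv: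
  assumes "0 \<le> r"
  shows "(E has_real_derivative r ^ (k - 1) * b r / C) (at r within {0..})"
proof -
  have "continuous_on {0..} (\<lambda>t. 1 / C * t ^ (k - 1) * b t)"
    by (intro continuous_intros b_cont)
  from integral_has_real_derivative_halfline[OF this assms] show ?thesis
    unfolding E_def[abs_def] by simp
qed

lemma E_cont: "continuous_on {0..} E"
  using E_deriv by (intro has_real_derivative_continuous_on) auto

lemma E_0: "E 0 = 0"
  by (simp add: E_def)

text \<open>\<open>M g r\<close> is \<open>r\<^sup>-\<^sup>N\<close> times the integral of \<open>B\<^sup>+ g\<close> over \<open>[0, r]\<close>, rescaled to the unit interval
  so that it is continuous at \<open>r = 0\<close>. A solution with source \<open>g = f(u\<^sub>1, u\<^sub>2)\<close> has \<open>u' = V g = r Z g\<close>.\<close>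

definition M :: "(real \<Rightarrow> real) \<Rightarrow> real \<Rightarrow> real" where
  "M g r = integral {0..1} (\<lambda>s. s ^ (N - 1) * (exp (E (r * s)) * p (r * s) * g (r * s)))"

text \<open>This is \<open>(u'/r) ^ k\<close>. It is kept apart from its root \<open>Z\<close>
  because it is differentiable at every \<open>r > 0\<close>, even where the root may fail to
  be.\<close>

definition \<zeta> :: "(real \<Rightarrow> real) \<Rightarrow> real \<Rightarrow> real" where
  "\<zeta> g r = exp (- E r) / C * M g r"

definition Z :: "(real \<Rightarrow> real) \<Rightarrow> real \<Rightarrow> real" where
  "Z g r = \<zeta> g r powr (1 / real k)"

definition V :: "(real \<Rightarrow> real) \<Rightarrow> real \<Rightarrow> real" where
  "V g r = r * Z g r"

lemma M_integrand_cont: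
  assumes "continuous_on {0..} g" "0 \<le> r"
  shows "continuous_on {0..1} (\<lambda>s. s ^ (N - 1) * (exp (E (r * s)) * p (r * s) * g (r * s)))"
proof -
  have *: "continuous_on {0..1} (\<lambda>s. f (r * s))" if "continuous_on {0..} f" for f :: "real \<Rightarrow> real"
    by (rule continuous_on_compose2[OF that]) (use assms(2) in \<open>auto intro!: continuous_intros\<close>)
  show ?thesis
    by (intro continuous_intros *[OF E_cont] *[OF p_cont] *[OF assms(1)])
qed

lemma M_cont:
  assumes g: "continuous_on {0..} g"
  shows "continuous_on {0..} (M g)"
proof -
  have *: "continuous_on ({0..} \<times> {0..1}) (\<lambda>x::real \<times> real. f (fst x * snd x))"
    if "continuous_on {0..} f" for f :: "real \<Rightarrow> real"
    by (rule continuous_on_compose2[OF that]) (auto intro!: continuous_intros)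
  have "continuous_on {0..} (\<lambda>r. integral (cbox 0 1)
      (\<lambda>s. s ^ (N - 1) * (exp (E (r * s)) * p (r * s) * g (r * s))))"
    by (rule integral_continuous_on_param)
       (auto simp: case_prod_unfold intro!: continuous_intros *[OF E_cont] *[OF p_cont] *[OF g])
  then show ?thesis by (simp add: M_def[abs_def])
qed

lemma M_integrable:
  assumes "continuous_on {0..} g" "0 \<le> r"
  shows "(\<lambda>s. s ^ (N - 1) * (exp (E (r * s)) * p (r * s) * g (r * s))) integrable_on {0..1}"
  by (rule integrable_continuous_real[OF M_integrand_cont[OF assms]])

lemma B_plus_eq: "B_plus N k b p t = t ^ (N - 1) * exp (E t) * p t"
  by (simp add: B_plus_def E_def)

lemma B_plus_cont: "continuous_on {0..} (B_plus N k b p)"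
  unfolding B_plus_eq[abs_def] using E_cont p_cont by (auto intro!: continuous_intros)

text \<open>Substitute \<open>t = r * s\<close>: the power in \<open>B_plus\<close> contributes
  \<open>r ^ (N - 1)\<close> and the change of variable one more factor \<open>r\<close>.\<close>

lemma M_eq:
  assumes g: "continuous_on {0..} g" and r: "0 \<le> r"
  shows "r ^ N * M g r = integral {0..r} (\<lambda>t. B_plus N k b p t * g t)"
proof (cases "r = 0")
  case False
  then have r: "0 < r" using r by simp
  let ?f = "\<lambda>t. B_plus N k b p t * g t"
  have "continuous_on {0..r} ?f"
    by (rule continuous_on_subset[of "{0..}"]) (auto intro!: continuous_intros B_plus_cont g)
  then have "(?f has_integral integral {0..r} ?f) {0..r}"
    by (intro integrable_integral integrable_continuous_real)
  from has_integral_stretch_real[OF this, of r]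
  have 1: "((\<lambda>s. ?f (r * s)) has_integral integral {0..r} ?f / r) {0..1}"
    using r by simp
  have "((\<lambda>s. r ^ (N - 1) * (s ^ (N - 1) * (exp (E (r * s)) * p (r * s) * g (r * s))))
      has_integral r ^ (N - 1) * M g r) {0..1}"
    unfolding M_def by (intro has_integral_mult_right integrable_integral M_integrable g) (use r in simp)
  also have "(\<lambda>s. r ^ (N - 1) * (s ^ (N - 1) * (exp (E (r * s)) * p (r * s) * g (r * s)))) = (\<lambda>s. ?f (r * s))"
    by (simp add: B_plus_eq power_mult_distrib mult_ac)
  finally have "r ^ (N - 1) * M g r = integral {0..r} ?f / r"
    using 1 has_integral_unique by blast
  moreover have "r ^ N = r * r ^ (N - 1)" using N_pos by (cases N) auto
  ultimately show ?thesis using r by (simp add: mult.assoc)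
qed (use N_pos in simp)

lemma \<zeta>_cont: "continuous_on {0..} g \<Longrightarrow> continuous_on {0..} (\<zeta> g)"
  unfolding \<zeta>_def[abs_def] using C_pos by (auto intro!: continuous_intros M_cont E_cont)

lemma Z_nonneg: "0 \<le> Z g r"
  by (simp add: Z_def)

lemma V_nonneg: "0 \<le> r \<Longrightarrow> 0 \<le> V g r"
  by (simp add: V_def Z_nonneg)

text \<open>The singular power in \<open>B_minus\<close> is absorbed by the \<open>r ^ N\<close> of
  \<open>M_eq\<close>, leaving \<open>r ^ k\<close>; at 0 the integral is over a point.\<close>

lemma B_minus_integral:
  assumes g: "continuous_on {0..} g" and r: "0 \<le> r"
  shows "B_minus N k b r * integral {0..r} (\<lambda>t. B_plus N k b p t * g t) = r ^ k * \<zeta> g r"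
proof (cases "r = 0")
  case False
  have "r powi (int k - int N) * r ^ N = r ^ k"
    using power_int_add[of r "int k - int N" "int N"] False by (simp add: power_int_of_nat)
  then show ?thesis
    unfolding M_eq[OF assms, symmetric] B_minus_def \<zeta>_def E_def by (simp add: field_simps)
qed (use k in simp)

lemma power_powr_inverse: "0 \<le> r \<Longrightarrow> (r ^ k) powr (1 / real k) = r"
  using k by (cases "r = 0") (auto simp: powr_powr simp flip: powr_realpow)

lemma V_eq:
  assumes g: "continuous_on {0..} g" and r: "0 \<le> r"
  shows "(B_minus N k b r * integral {0..r} (\<lambda>t. B_plus N k b p t * g t)) powr (1 / real k) = V g r"
  unfolding B_minus_integral[OF assms] V_def Z_def
  using r by (subst powr_mult) (simp_all add: power_powr_inverse)

lemma P_fun_eq: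
  assumes "0 \<le> r"
  shows "P_fun N k b p r = integral {0..r} (V (\<lambda>_. 1))"
  unfolding P_fun_def
  by (rule integral_cong) (use V_eq[of "\<lambda>_. 1"] in auto)

lemma M_mono:
  assumes "continuous_on {0..} g" "continuous_on {0..} g'" "0 \<le> r"
    and "\<And>t. 0 \<le> t \<Longrightarrow> t \<le> r \<Longrightarrow> g t \<le> g' t"
  shows "M g r \<le> M g' r"
  unfolding M_def
proof (rule integral_le)
  fix s :: real assume "s \<in> {0..1}"
  then have "0 \<le> r * s" "r * s \<le> r" using assms(3) by (auto simp: mult_left_le)
  then show "s ^ (N - 1) * (exp (E (r * s)) * p (r * s) * g (r * s))
      \<le> s ^ (N - 1) * (exp (E (r * s)) * p (r * s) * g' (r * s))"
    using \<open>s \<in> {0..1}\<close> by (intro mult_left_mono assms(4)) (auto simp: p_nonneg)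
qed (intro M_integrable assms)+

lemma M_const: "M (\<lambda>_. c) r = c * M (\<lambda>_. 1) r"
proof -
  have "(\<lambda>s. s ^ (N - 1) * (exp (E (r * s)) * p (r * s) * c))
      = (\<lambda>s. c * (s ^ (N - 1) * (exp (E (r * s)) * p (r * s) * 1)))"
    by (simp add: fun_eq_iff)
  then show ?thesis
    unfolding M_def by (simp only: integral_mult_right)
qed

lemma M_nonneg:
  assumes "continuous_on {0..} g" "0 \<le> r" "\<And>t. 0 \<le> t \<Longrightarrow> 0 \<le> g t"
  shows "0 \<le> M g r"
  using M_mono[of "\<lambda>_. 0" g r] assms by (simp add: M_const[of 0])

lemma \<zeta>_nonneg:
  assumes "continuous_on {0..} g" "0 \<le> r" "\<And>t. 0 \<le> t \<Longrightarrow> 0 \<le> g t"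
  shows "0 \<le> \<zeta> g r"
  using M_nonneg[OF assms] C_pos by (simp add: \<zeta>_def)

lemma Z_cont:
  assumes "continuous_on {0..} g" "\<And>t. 0 \<le> t \<Longrightarrow> 0 \<le> g t"
  shows "continuous_on {0..} (Z g)"
  unfolding Z_def[abs_def] using k \<zeta>_nonneg[OF assms(1) _ assms(2)]
  by (intro continuous_on_powr' \<zeta>_cont continuous_intros assms) auto

lemma V_cont:
  assumes "continuous_on {0..} g" "\<And>t. 0 \<le> t \<Longrightarrow> 0 \<le> g t"
  shows "continuous_on {0..} (V g)"
  unfolding V_def[abs_def] by (intro continuous_intros Z_cont assms)

lemma P_deriv:
  assumes "0 \<le> r"
  shows "(P_fun N k b p has_real_derivative V (\<lambda>_. 1) r) (at r within {0..})"
proof -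
  have "((\<lambda>r. integral {0..r} (V (\<lambda>_. 1))) has_real_derivative V (\<lambda>_. 1) r) (at r within {0..})"
    by (intro integral_has_real_derivative_halfline V_cont assms) auto
  then show ?thesis
    by (rule has_field_derivative_transform_within[where d = 1]) (use assms in \<open>auto simp: P_fun_eq\<close>)
qed

lemma Z_mono:
  assumes "continuous_on {0..} g" "continuous_on {0..} g'" "0 \<le> r"
    and "\<And>t. 0 \<le> t \<Longrightarrow> 0 \<le> g t" and "\<And>t. 0 \<le> t \<Longrightarrow> t \<le> r \<Longrightarrow> g t \<le> g' t"
  shows "Z g r \<le> Z g' r"
  unfolding Z_def
proof (rule powr_mono2)
  show "\<zeta> g r \<le> \<zeta> g' r"
    unfolding \<zeta>_def using C_pos by (intro mult_left_mono M_mono assms) auto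
qed (use assms \<zeta>_nonneg in auto)

text \<open>\<open>Z\<close> is homogeneous of degree \<open>1/k\<close> in the source. This is the
  origin of the roots of \<open>f1\<close> and \<open>f2\<close> in \<open>F\<close> and in the
  lower bounds.\<close>

lemma Z_const:
  assumes "0 \<le> c" "0 \<le> r"
  shows "Z (\<lambda>_. c) r = c powr (1 / real k) * Z (\<lambda>_. 1) r"
proof -
  have "\<zeta> (\<lambda>_. c) r = c * \<zeta> (\<lambda>_. 1) r" by (simp add: \<zeta>_def M_const[of c])
  then show ?thesis
    unfolding Z_def using assms \<zeta>_nonneg[of "\<lambda>_. 1" r] by (simp add: powr_mult)
qed

lemma V_mono:
  assumes "continuous_on {0..} g" "continuous_on {0..} g'" "0 \<le> r"
    and "\<And>t. 0 \<le> t \<Longrightarrow> 0 \<le> g t" and "\<And>t. 0 \<le> t \<Longrightarrow> t \<le> r \<Longrightarrow> g t \<le> g' t"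
  shows "V g r \<le> V g' r"
  unfolding V_def by (intro mult_left_mono Z_mono assms) auto

lemma V_const: "0 \<le> c \<Longrightarrow> 0 \<le> r \<Longrightarrow> V (\<lambda>_. c) r = c powr (1 / real k) * V (\<lambda>_. 1) r"
  by (simp add: V_def Z_const[of c] mult_ac)

text \<open>\<open>\<psi> g\<close> is the derivative of \<open>V g\<close>. Where \<open>Z g = 0\<close> and \<open>k > 1\<close>, the quotient \<open>\<phi> g\<close> is \<open>0\<close> by
  the convention on division.\<close>

definition \<phi> :: "(real \<Rightarrow> real) \<Rightarrow> real \<Rightarrow> real" where
  "\<phi> g r = p r * g r / Z g r ^ (k - 1)"

definition \<psi> :: "(real \<Rightarrow> real) \<Rightarrow> real \<Rightarrow> real" where
  "\<psi> g r = ((real k - real N) * Z g r - r ^ k * b r / C * Z g r + \<phi> g r / C) / real k"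

section \<open>Differentiating \<open>V\<close> for a fixed source\<close>

context
  fixes g assumes g: "regular_source g"
begin

lemma g_cont: "continuous_on {0..} g"
  and g_mono: "0 \<le> s \<Longrightarrow> s \<le> t \<Longrightarrow> g s \<le> g t"
  and g_0: "0 < g 0"
  using g by (auto simp: regular_source_def mono_on_def)

lemma g_pos: "0 \<le> t \<Longrightarrow> 0 < g t"
  using g_mono[of 0 t] g_0 by simp

lemma g_nonneg: "0 \<le> t \<Longrightarrow> 0 \<le> g t"
  using g_pos[of t] by simp

lemma Z_upper:
  assumes "0 \<le> s" "s \<le> r"
  shows "Z g s \<le> g r powr (1 / real k) * Z (\<lambda>_. 1) s"
proof -
  have "Z g s \<le> Z (\<lambda>_. g r) s"
    by (rule Z_mono) (use assms g_mono g_nonneg g_cont in auto)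
  then show ?thesis using Z_const[of "g r" s] g_nonneg[of r] assms by simp
qed

lemma Z_lower:
  assumes "0 \<le> r"
  shows "g 0 powr (1 / real k) * Z (\<lambda>_. 1) r \<le> Z g r"
proof -
  have "Z (\<lambda>_. g 0) r \<le> Z g r"
    by (rule Z_mono) (use assms g_mono g_0 g_cont in auto)
  then show ?thesis using Z_const[of "g 0" r] g_0 assms by simp
qed

text \<open>The two preceding bounds hold \<open>Z g\<close> between multiples of
  \<open>Z (\<lambda>_. 1)\<close>, so the degenerate radii do not depend on the source.\<close>

lemma Z_eq_0_iff: "0 \<le> r \<Longrightarrow> Z g r = 0 \<longleftrightarrow> Z (\<lambda>_. 1) r = 0"
  using Z_lower[of r] Z_upper[of r r] Z_nonneg[of g r] Z_nonneg[of "\<lambda>_. 1" r] g_0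
  by (auto simp: mult_le_0_iff)

lemma Z_power: "0 \<le> r \<Longrightarrow> Z g r ^ k = \<zeta> g r"
  using \<zeta>_nonneg[OF g_cont, of r] g_nonneg k unfolding Z_def
  by (cases "\<zeta> g r = 0") (auto simp: powr_powr simp flip: powr_realpow)

text \<open>A nonnegative continuous integrand with integral 0 vanishes identically, and for
  \<open>s > 0\<close> all its factors other than \<open>p\<close> are positive.\<close>

lemma Z_eq_0_imp_p_eq_0:
  assumes "0 \<le> r" "Z g r = 0" "0 < s" "s \<le> 1"
  shows "p (r * s) = 0"
proof -
  let ?f = "\<lambda>s. s ^ (N - 1) * (exp (E (r * s)) * p (r * s) * g (r * s))"
  have "\<zeta> g r = 0" using Z_power[of r] assms k by (simp add: zero_power)
  then have "integral {0..1} ?f = 0" using C_pos by (simp add: \<zeta>_def M_def)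
  moreover have "0 \<le> ?f s" if "s \<in> {0..1}" for s
    using that assms(1) by (auto intro!: mult_nonneg_nonneg p_nonneg g_nonneg)
  ultimately have "\<forall>s\<in>{0..1}. ?f s = 0"
    using integral_eq_0_iff[of 0 1 ?f] M_integrand_cont[OF g_cont assms(1)] by auto
  then have "?f s = 0" by (rule bspec) (use assms(3,4) in simp)
  then show ?thesis using assms g_pos[of "r * s"] by auto
qed

lemma Z_eq_0_imp_p_0_eq_0:
  assumes "0 \<le> r" "Z g r = 0"
  shows "p 0 = 0"
proof -
  have "p (r * 0) = 0"
  \<comment> \<open>The weight \<open>s ^ (N - 1)\<close> can hide \<open>p\<close> at
    \<open>s = 0\<close>; continuity supplies this value.\<close>
  proof (rule continuous_constant_on_closure[of "{0<..1}" "\<lambda>s. p (r * s)"])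
    show "continuous_on (closure {0<..1}) (\<lambda>s. p (r * s))"
      using assms(1) by (auto intro!: continuous_on_compose2[OF p_cont] continuous_intros)
  qed (use assms Z_eq_0_imp_p_eq_0 in auto)
  then show ?thesis by simp
qed

text \<open>Multiplying back is correct at zeros of \<open>Z g\<close> too, because \<open>p\<close>
  vanishes there.\<close>

lemma Z_power_\<phi>:
  assumes "0 \<le> r"
  shows "Z g r ^ (k - 1) * \<phi> g r = p r * g r"
proof (cases "Z g r = 0")
  case True
  then show ?thesis using Z_eq_0_imp_p_eq_0[of r 1] assms by (simp add: \<phi>_def)
qed (simp add: \<phi>_def)

text \<open>At radius 0 the integrand of \<open>M\<close> is a constant times
  \<open>s ^ (N - 1)\<close>, so \<open>Z g 0 ^ k = p 0 * g 0 / (N * C)\<close>. Hence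
  \<open>\<phi> g 0 / C = N * Z g 0\<close>, which the term with \<open>k - N\<close> completes to
  \<open>k * Z g 0\<close>.\<close>

lemma \<psi>_0: "\<psi> g 0 = Z g 0"
proof -
  have "((\<lambda>s. s ^ (N - 1)) has_integral (1 ^ N / real N - 0 ^ N / real N)) {0..1::real}"
    by (rule fundamental_theorem_of_calculus)
       (use N_pos in \<open>auto intro!: derivative_eq_intros simp flip: has_real_derivative_iff_has_vector_derivative\<close>)
  then have "((\<lambda>s. s ^ (N - 1) * (p 0 * g 0)) has_integral (1 / real N * (p 0 * g 0))) {0..1::real}"
    using N_pos by (intro has_integral_mult_left) (simp add: zero_power)
  then have "M g 0 = 1 / real N * (p 0 * g 0)"
    unfolding M_def by (simp only: E_0 mult_zero_left exp_zero mult_1 integral_unique)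
  then have Zk: "Z g 0 ^ k = p 0 * g 0 / (real N * C)"
    using Z_power[of 0] by (simp add: \<zeta>_def E_0 mult_ac)
  have "\<phi> g 0 / C = real N * Z g 0"
  proof (cases "Z g 0 = 0")
    case True
    then show ?thesis using Z_eq_0_imp_p_0_eq_0[of 0] by (simp add: \<phi>_def)
  next
    case False
    have "p 0 * g 0 = real N * C * (Z g 0 * Z g 0 ^ (k - 1))"
      using Zk C_pos N_pos k power_minus_mult[of k "Z g 0"] by (simp add: field_simps)
    then show ?thesis using False C_pos by (simp add: \<phi>_def)
  qed
  then show ?thesis using k by (simp add: \<psi>_def field_simps)
qed

text \<open>The difference quotient of \<open>r * Z g r\<close> at 0 is \<open>Z g\<close> itself,
  so continuity of \<open>Z g\<close> is enough, whether or not it vanishes.\<close>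

lemma V_deriv_0: "(V g has_real_derivative \<psi> g 0) (at 0 within {0..})"
proof -
  have "(Z g \<longlongrightarrow> Z g 0) (at 0 within {0..})"
    using Z_cont[OF g_cont g_nonneg] by (simp add: continuous_on_def)
  then have "((\<lambda>y. (V g y - V g 0) / (y - 0)) \<longlongrightarrow> Z g 0) (at 0 within {0..})"
    by (rule Lim_transform_eventually) (auto simp: eventually_at_filter V_def)
  then show ?thesis by (simp add: has_field_derivative_iff \<psi>_0)
qed

text \<open>The rescaled integral \<open>M\<close> cannot be differentiated under the integral sign,
  since \<open>p\<close> and \<open>g\<close> are merely continuous. For \<open>r > 0\<close> one
  returns to the integral over \<open>[0, r]\<close> and uses the fundamental theorem of
  calculus.\<close>

lemma \<zeta>_deriv:
  assumes r: "0 < r"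
  shows "(\<zeta> g has_real_derivative
    - (r ^ (k - 1) * b r / C) * \<zeta> g r + p r * g r / (C * r) - real N * \<zeta> g r / r) (at r)"
proof -
  let ?I = "\<lambda>r. integral {0..r} (\<lambda>t. B_plus N k b p t * g t)"
  have at: "at r within {0..} = at r" using r by (intro at_within_interior) simp
  have I: "(?I has_real_derivative B_plus N k b p r * g r) (at r)"
    using integral_has_real_derivative_halfline[of 0 "\<lambda>t. B_plus N k b p t * g t" r] r at
    by (auto intro!: continuous_intros B_plus_cont g_cont)
  have E: "(E has_real_derivative r ^ (k - 1) * b r / C) (at r)"
    using E_deriv[of r] r at by simp
  have M: "M g s = ?I s / s ^ N" if "0 < s" for s
    using M_eq[OF g_cont, of s] that by (simp add: field_simps)
  have "((\<lambda>s. exp (- E s) / C * (?I s / s ^ N)) has_real_derivative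
    - (r ^ (k - 1) * b r / C) * \<zeta> g r + p r * g r / (C * r) - real N * \<zeta> g r / r) (at r)"
  proof -
    have 1: "((\<lambda>s. exp (- E s) / C) has_real_derivative
        - (r ^ (k - 1) * b r / C) * (exp (- E r) / C)) (at r)"
      by (rule derivative_eq_intros E refl)+ (use C_pos in auto)
    have 2: "((\<lambda>s. ?I s / s ^ N) has_real_derivative
        (B_plus N k b p r * g r * r ^ N - ?I r * (real N * r ^ (N - 1))) / (r ^ N * r ^ N)) (at r)"
      by (rule DERIV_divide[OF I]) (use r DERIV_pow[of N r UNIV] in simp_all)
    have rN: "r ^ N = r * r ^ (N - 1)" using N_pos by (cases N) auto
    have "(B_plus N k b p r * g r * r ^ N - ?I r * (real N * r ^ (N - 1))) / (r ^ N * r ^ N)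
        = B_plus N k b p r * g r / r ^ N - real N * M g r / r"
      using r unfolding M[OF r] diff_divide_distrib by (simp add: rN mult_ac)
    also have "\<dots> = exp (E r) * p r * g r / r - real N * M g r / r"
      using r by (simp add: B_plus_eq rN)
    finally have eq: "(B_plus N k b p r * g r * r ^ N - ?I r * (real N * r ^ (N - 1))) / (r ^ N * r ^ N)
        = exp (E r) * p r * g r / r - real N * M g r / r" .
    have *: "exp (- E r) / C * ((B_plus N k b p r * g r * r ^ N - ?I r * (real N * r ^ (N - 1))) / (r ^ N * r ^ N))
        = p r * g r / (C * r) - real N * \<zeta> g r / r"
      unfolding eq using r C_pos by (simp add: \<zeta>_def exp_minus field_simps)
    show ?thesis
      by (rule DERIV_cong[OF DERIV_mult[OF 1 2]]) (use * M[OF r] in \<open>simp add: \<zeta>_def mult_ac\<close>)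
  qed
  then show ?thesis
    by (rule has_field_derivative_transform_within_open[of _ _ _ "{0<..}"])
       (use r in \<open>auto simp: \<zeta>_def M\<close>)
qed

text \<open>For \<open>k > 1\<close> the chain rule for the root requires
  \<open>\<zeta> g r > 0\<close>; for \<open>k = 1\<close> the root is the identity on nonnegative
  values and zeros are harmless.\<close>

lemma V_deriv_pos:
  assumes r: "0 < r" and Z: "Z g r \<noteq> 0 \<or> k = 1"
  shows "(V g has_real_derivative \<psi> g r) (at r)"
proof (cases "k = 1")
  case True
  have k1: "r ^ (k - 1) = 1" "r ^ k = r" "Z g r ^ (k - 1) = 1" "real k = 1" using True by simp_all
  have Z: "Z g s = \<zeta> g s" if "0 < s" for s using Z_power[of s] True that by simp
  let ?d = "- (r ^ (k - 1) * b r / C) * \<zeta> g r + p r * g r / (C * r) - real N * \<zeta> g r / r"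
  have "\<zeta> g r + r * ?d = \<psi> g r"
    unfolding \<psi>_def \<phi>_def k1 unfolding Z[OF r] using r C_pos by (simp add: field_simps)
  then have "((\<lambda>r. r * \<zeta> g r) has_real_derivative \<psi> g r) (at r)"
    using DERIV_mult[OF DERIV_ident \<zeta>_deriv[OF r]] by (simp add: mult.commute)
  then show ?thesis
    by (rule has_field_derivative_transform_within_open[of _ _ _ "{0<..}"])
       (use r Z in \<open>auto simp: V_def\<close>)
next
  case False
  then have Zr: "0 < Z g r" using Z Z_nonneg[of g r] by simp
  then have \<zeta>r: "0 < \<zeta> g r" using Z_power[of r] r by (metis less_imp_le zero_less_power)
  \<comment> \<open>This turns the chain-rule factor
    \<open>\<zeta> g r powr (1 / real k - 1)\<close> into the division by
    \<open>Z g r ^ (k - 1)\<close> in \<open>\<phi>\<close>.\<close>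
  have pw: "\<zeta> g r powr (1 / real k - 1) * Z g r ^ (k - 1) = 1"
  proof -
    have "Z g r ^ (k - 1) = \<zeta> g r powr (1 / real k * (real k - 1))"
      using \<zeta>r k by (simp add: Z_def powr_powr of_nat_diff flip: powr_realpow)
    also have "1 / real k * (real k - 1) = 1 - 1 / real k" using k by (simp add: field_simps)
    finally show ?thesis using \<zeta>r by (simp flip: powr_add)
  qed
  have Zpw: "\<zeta> g r powr (1 / real k - 1) * \<zeta> g r = Z g r"
    using \<zeta>r powr_add[of "\<zeta> g r" "1 / real k - 1" 1] by (simp add: Z_def)
  let ?q = "\<zeta> g r powr (1 / real k - 1)"
  let ?d = "- (r ^ (k - 1) * b r / C) * \<zeta> g r + p r * g r / (C * r) - real N * \<zeta> g r / r"
  have "(Z g has_real_derivative (1 / real k) * ?q * ?d) (at r)"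
    unfolding Z_def[abs_def] by (rule DERIV_fun_powr[OF \<zeta>_deriv[OF r], THEN DERIV_cong]) (use \<zeta>r in auto)
  then have "(V g has_real_derivative r * ((1 / real k) * ?q * ?d) + 1 * Z g r) (at r)"
    unfolding V_def[abs_def] by (intro derivative_eq_intros) auto
  moreover have "r * ((1 / real k) * ?q * ?d) + 1 * Z g r = \<psi> g r"
  proof -
    have \<phi>: "\<phi> g r = ?q * (p r * g r)" using pw Zr by (simp add: \<phi>_def field_simps)
    have rk: "r ^ k = r * r ^ (k - 1)" using k by (cases k) auto
    have "r * ((1 / real k) * ?q * ?d) = (- (r ^ k * b r / C) * (?q * \<zeta> g r)
       + ?q * (p r * g r) / C - real N * (?q * \<zeta> g r)) / real k"
      using r C_pos k by (simp add: rk field_simps)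
    then show ?thesis
      unfolding Zpw \<psi>_def \<phi> using k by (simp add: field_simps)
  qed
  ultimately show ?thesis by simp
qed

end

text \<open>Zeros of \<open>P' = V 1\<close> are minima, so \<open>P''\<close> vanishes there and agrees with \<open>\<psi> 1\<close>.\<close>

lemma P_C2_imp_V_deriv:
  assumes P: "C2_halfline (P_fun N k b p)" and r: "0 \<le> r"
  shows "(V (\<lambda>_. 1) has_real_derivative \<psi> (\<lambda>_. 1) r) (at r within {0..})"
    and "continuous_on {0..} (\<psi> (\<lambda>_. 1))"
proof -
  obtain u' d where u': "\<And>r. 0 \<le> r \<Longrightarrow> (P_fun N k b p has_real_derivative u' r) (at r within {0..})"
    and d: "\<And>r. 0 \<le> r \<Longrightarrow> (u' has_real_derivative d r) (at r within {0..})"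
    and d_cont: "continuous_on {0..} d"
    using P unfolding C2_halfline_def by blast
  have "u' r = V (\<lambda>_. 1) r" if "0 \<le> r" for r
    using has_real_derivative_unique_halfline[OF u' P_deriv] that by simp
  then have V: "(V (\<lambda>_. 1) has_real_derivative d r) (at r within {0..})" if "0 \<le> r" for r
    by (intro has_field_derivative_transform_within[OF d, of r 1]) (use that in auto)
  have eq: "\<psi> (\<lambda>_. 1) r = d r" if r: "0 \<le> r" for r
  proof (cases "r = 0")
    case True
    then show ?thesis
      using has_real_derivative_unique_halfline[OF V[of 0] V_deriv_0[OF regular_source_1]] by simp
  next
    case False
    then have r: "0 < r" using r by simp
    have at: "at r within {0..} = at r" using r by (intro at_within_interior) simp
    show ?thesis
    proof (cases "Z (\<lambda>_. 1) r \<noteq> 0 \<or> k = 1")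
      case True
      from V_deriv_pos[OF regular_source_1 r True] V[of r] show ?thesis
        using r at by (auto intro: DERIV_unique)
    next
      case False
      then have Z: "Z (\<lambda>_. 1) r = 0" and k1: "k \<noteq> 1" by auto
      \<comment> \<open>The last \<open>r\<close> in the instantiation is the radius of the
        neighbourhood, which keeps it in the half-line where \<open>V\<close> is
        nonnegative.\<close>
      have "d r = 0"
        by (rule DERIV_local_min[of "V (\<lambda>_. 1)" "d r" r r])
           (use V[of r] at r Z V_nonneg[of _ "\<lambda>_. 1"] in \<open>auto simp: V_def[of _ r]\<close>)
      then show ?thesis using Z k k1 by (simp add: \<psi>_def \<phi>_def)
    qed
  qed
  show "(V (\<lambda>_. 1) has_real_derivative \<psi> (\<lambda>_. 1) r) (at r within {0..})"
    using V r eq by simp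
  show "continuous_on {0..} (\<psi> (\<lambda>_. 1))"
    using d_cont by (rule continuous_on_eq) (use eq in auto)
qed

text \<open>A zero of \<open>Z g\<close> forces \<open>p 0 = 0\<close>, so for
  \<open>k \<noteq> 1\<close> only the third alternative of \<open>C2_compatible\<close> is
  left.\<close>

lemma C2_compatible_degenerate:
  assumes "C2_compatible N k b p" "regular_source g" "0 \<le> r" "Z g r = 0" "k \<noteq> 1"
  shows "C2_halfline (P_fun N k b p)"
  using assms Z_eq_0_imp_p_0_eq_0[of g r] by (auto simp: C2_compatible_def)

text \<open>At a degenerate radius \<open>r > 0\<close>, \<open>V g\<close> is at most
  \<open>g (r + 1) powr (1 / real k)\<close> times \<open>V (\<lambda>_. 1)\<close> for all
  arguments below \<open>r + 1\<close>. The latter has value and derivative 0 at \<open>r\<close>,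
  so the former has too.\<close>

lemma V_deriv:
  assumes comp: "C2_compatible N k b p" and g: "regular_source g" and r: "0 \<le> r"
  shows "(V g has_real_derivative \<psi> g r) (at r within {0..})"
proof (cases "r = 0")
  case True
  then show ?thesis using V_deriv_0[OF g] by simp
next
  case False
  then have r0: "0 < r" using r by simp
  show ?thesis
  proof (cases "Z g r \<noteq> 0 \<or> k = 1")
    case True
    from V_deriv_pos[OF g r0 True] show ?thesis by (rule has_field_derivative_at_within)
  next
    case False
    then have Z: "Z g r = 0" and k1: "k \<noteq> 1" by auto
    then have Z1: "Z (\<lambda>_. 1) r = 0" using Z_eq_0_iff[OF g r] by simp
    have \<psi>0: "\<psi> g r = 0" "\<psi> (\<lambda>_. 1) r = 0" using Z Z1 k k1 by (auto simp: \<psi>_def \<phi>_def)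
    have "((\<lambda>y. V (\<lambda>_. 1) y / (y - r)) \<longlongrightarrow> 0) (at r within {0..})"
      using P_C2_imp_V_deriv(1)[OF C2_compatible_degenerate[OF comp g r Z k1] r] Z1 \<psi>0
      by (simp add: has_field_derivative_iff V_def[of _ r])
    then have "((\<lambda>y. g (r + 1) powr (1 / real k) * \<bar>V (\<lambda>_. 1) y / (y - r)\<bar>) \<longlongrightarrow> 0) (at r within {0..})"
      by (intro tendsto_mult_right_zero tendsto_rabs_zero)
    then have "((\<lambda>y. (V g y - V g r) / (y - r)) \<longlongrightarrow> 0) (at r within {0..})"
    proof (rule Lim_null_comparison[rotated])
      have "\<forall>\<^sub>F y in at r within {0..}. y \<in> {..<r + 1}"
        by (rule eventually_at_topological[THEN iffD2]) (auto intro!: exI[of _ "{..<r + 1}"])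
      moreover have "\<forall>\<^sub>F y in at r within {0..}. y \<in> {0..}"
        by (auto simp: eventually_at_filter)
      ultimately show "\<forall>\<^sub>F y in at r within {0..}. norm ((V g y - V g r) / (y - r))
          \<le> g (r + 1) powr (1 / real k) * \<bar>V (\<lambda>_. 1) y / (y - r)\<bar>"
      proof eventually_elim
        case (elim y)
        then have "V g y \<le> g (r + 1) powr (1 / real k) * V (\<lambda>_. 1) y"
          using mult_left_mono[OF Z_upper[OF g, of y "r + 1"], of y] by (auto simp: V_def mult_ac)
        then have "\<bar>V g y\<bar> \<le> g (r + 1) powr (1 / real k) * \<bar>V (\<lambda>_. 1) y\<bar>"
          using V_nonneg elim by auto
        then have "\<bar>V g y\<bar> / \<bar>y - r\<bar> \<le> g (r + 1) powr (1 / real k) * \<bar>V (\<lambda>_. 1) y\<bar> / \<bar>y - r\<bar>"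
          by (rule divide_right_mono) simp
        then show ?case using Z by (simp add: V_def[of _ r])
      qed
    qed
    then show ?thesis by (simp add: has_field_derivative_iff \<psi>0)
  qed
qed

text \<open>Near a zero of \<open>Z g\<close>, \<open>\<phi> g\<close> is dominated by a multiple of \<open>\<phi> 1\<close>, which is continuous because it
  can be solved for in \<open>\<psi> 1 = P''\<close>.\<close>

lemma \<phi>_cont:
  assumes comp: "C2_compatible N k b p" and g: "regular_source g"
  shows "continuous_on {0..} (\<phi> g)"
  unfolding continuous_on_eq_continuous_within
proof
  fix r :: real assume "r \<in> {0..}"
  then have r: "0 \<le> r" by simp
  have gc: "continuous (at r within {0..}) g" using g_cont[OF g] r by (simp add: continuous_on_eq_continuous_within)
  have pc: "continuous (at r within {0..}) p" using p_cont r by (simp add: continuous_on_eq_continuous_within)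
  have Zc: "continuous (at r within {0..}) (Z g)" using Z_cont[OF g_cont[OF g] g_nonneg[OF g]] r by (simp add: continuous_on_eq_continuous_within)
  show "continuous (at r within {0..}) (\<phi> g)"
  proof (cases "Z g r \<noteq> 0 \<or> k = 1")
    case True
    then show ?thesis unfolding \<phi>_def[abs_def]
      by (intro continuous_at_within_divide continuous_mult continuous_power pc gc Zc) auto
  next
    case False
    then have Z: "Z g r = 0" and k1: "k \<noteq> 1" by auto
    then have Z1: "Z (\<lambda>_. 1) r = 0" using Z_eq_0_iff[OF g r] by simp
    have \<phi>0: "\<phi> g r = 0" "\<phi> (\<lambda>_. 1) r = 0" using Z Z1 k k1 by (auto simp: \<phi>_def)
    have "continuous_on {0..} (\<lambda>s. C * (real k * \<psi> (\<lambda>_. 1) s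
        - ((real k - real N) * Z (\<lambda>_. 1) s - s ^ k * b s / C * Z (\<lambda>_. 1) s)))"
      using C_pos
      by (intro continuous_intros b_cont Z_cont P_C2_imp_V_deriv(2)[OF C2_compatible_degenerate[OF comp g r Z k1] r]) auto
    also have "(\<lambda>s. C * (real k * \<psi> (\<lambda>_. 1) s
        - ((real k - real N) * Z (\<lambda>_. 1) s - s ^ k * b s / C * Z (\<lambda>_. 1) s))) = \<phi> (\<lambda>_. 1)"
      using C_pos k by (simp add: \<psi>_def fun_eq_iff)
    finally have \<phi>1: "(\<phi> (\<lambda>_. 1) \<longlongrightarrow> 0) (at r within {0..})"
      unfolding continuous_on_def using r \<phi>0 by (metis atLeast_iff)
    have gl: "(g \<longlongrightarrow> g r) (at r within {0..})" using gc by (simp add: continuous_within)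
    \<comment> \<open>\<open>c\<close> is the constant of \<open>Z_lower\<close> raised to the power
      \<open>k - 1\<close>: it bounds the denominator of \<open>\<phi> g\<close> below by
      \<open>c\<close> times that of \<open>\<phi> (\<lambda>_. 1)\<close>.\<close>
    define c where "c = (g 0 powr (1 / real k)) ^ (k - 1)"
    have c: "0 < c" using g_0[OF g] by (simp add: c_def)
    have "((\<lambda>s. g s / c * \<phi> (\<lambda>_. 1) s) \<longlongrightarrow> g r / c * 0) (at r within {0..})"
      using c by (intro tendsto_intros gl \<phi>1) auto
    then have "((\<lambda>s. g s / c * \<phi> (\<lambda>_. 1) s) \<longlongrightarrow> 0) (at r within {0..})" by simp
    then have "(\<phi> g \<longlongrightarrow> 0) (at r within {0..})"
    proof (rule Lim_null_comparison[rotated])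
      have "norm (\<phi> g s) \<le> g s / c * \<phi> (\<lambda>_. 1) s" if s: "0 \<le> s" for s
      proof (cases "Z g s = 0")
        case True
        then show ?thesis
          using Z_eq_0_iff[OF g s] k k1 by (simp add: \<phi>_def zero_power)
      next
        case False
        then have Z1s: "0 < Z (\<lambda>_. 1) s" using Z_eq_0_iff[OF g s] Z_nonneg[of "\<lambda>_. 1" s] by simp
        have "c * Z (\<lambda>_. 1) s ^ (k - 1) \<le> Z g s ^ (k - 1)"
          unfolding c_def power_mult_distrib[symmetric]
          by (intro power_mono Z_lower[OF g] s) (simp add: Z_nonneg)
        then have "p s * g s / Z g s ^ (k - 1) \<le> p s * g s / (c * Z (\<lambda>_. 1) s ^ (k - 1))"
          using c Z1s p_nonneg[OF s] g_nonneg[OF g s] False Z_nonneg[of g s] by (intro divide_left_mono) auto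
        then show ?thesis
          using p_nonneg[OF s] g_nonneg[OF g s] Z_nonneg[of g s] by (simp add: \<phi>_def field_simps)
      qed
      then show "\<forall>\<^sub>F s in at r within {0..}. norm (\<phi> g s) \<le> g s / c * \<phi> (\<lambda>_. 1) s"
        by (auto simp: eventually_at_filter)
    qed
    then show ?thesis by (simp add: continuous_within \<phi>0)
  qed
qed

lemma \<psi>_cont:
  assumes "C2_compatible N k b p" "regular_source g"
  shows "continuous_on {0..} (\<psi> g)"
  unfolding \<psi>_def[abs_def] using C_pos k
  by (intro continuous_intros \<phi>_cont[OF assms] b_cont Z_cont g_cont[OF assms(2)] g_nonneg[OF assms(2)]) auto

section \<open>Solutions of a single equation\<close>

lemma radial_profile_solution:
  assumes "C2_compatible N k b p" "regular_source g"
    and u: "\<And>r. 0 \<le> r \<Longrightarrow> u r = a + integral {0..r} (V g)"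
  shows "radial_profile u (Z g) (\<psi> g)"
proof
  fix r :: real assume r: "0 \<le> r"
  have "((\<lambda>r. a + integral {0..r} (V g)) has_real_derivative 0 + V g r) (at r within {0..})"
    by (intro DERIV_add DERIV_const integral_has_real_derivative_halfline V_cont g_cont[OF assms(2)] g_nonneg[OF assms(2)] r)
  then have "(u has_real_derivative 0 + V g r) (at r within {0..})"
    by (rule has_field_derivative_transform_within[where d = 1]) (use r u in auto)
  then show "(u has_real_derivative r * Z g r) (at r within {0..})"
    by (simp add: V_def)
  show "((\<lambda>r. r * Z g r) has_real_derivative \<psi> g r) (at r within {0..})"
    using V_deriv[OF assms(1,2) r] by (simp add: V_def[abs_def])
qed (use assms \<psi>_cont Z_cont g_cont g_nonneg \<psi>_0 in auto)

text \<open>These identities explain the normalisation \<open>C_const\<close>: the two binomial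
  coefficients of the radial Hessian operator share the factor \<open>C\<close>.\<close>

lemma C_binomial: "of_nat ((N - 1) choose k) = C * (real N - real k)"
  "of_nat ((N - 1) choose (k - 1)) = C * real k"
proof -
  have "fact k = real k * fact (k - 1)" using k by (intro fact_reduce) auto
  then show "of_nat ((N - 1) choose (k - 1)) = C * real k"
    using k by (simp add: C_const_def binomial_fact)
  show "of_nat ((N - 1) choose k) = C * (real N - real k)"
  proof (cases "k = N")
    case False
    then have "fact (N - k) = real (N - k) * fact (N - k - 1)" using k by (intro fact_reduce) auto
    then show ?thesis
      using k False by (simp add: C_const_def binomial_fact of_nat_diff)
  qed (use N_pos in simp)
qed

text \<open>Multiply the formula for \<open>\<psi>\<close> by \<open>C * k * Z ^ (k - 1)\<close>.
  The term with \<open>b\<close> becomes \<open>norm (gradient _) ^ k\<close>, and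
  \<open>\<phi>\<close> occurs only times \<open>Z ^ (k - 1)\<close>, so degenerate radii need no
  separate treatment.\<close>

lemma radial_solution:
  fixes x :: "real ^ 'n"
  assumes N: "N = CARD('n)" and comp: "C2_compatible N k b p" and g: "regular_source g"
    and u: "\<And>r. 0 \<le> r \<Longrightarrow> u r = a + integral {0..r} (V g)"
  shows "hessian_operator k (radial u) x + b (norm x) * norm (gradient (radial u) x) ^ k
    = p (norm x) * g (norm x)"
proof -
  interpret radial_profile u "Z g" "\<psi> g"
    by (rule radial_profile_solution[OF comp g u])
  let ?r = "norm x"
  have zk: "Z g ?r ^ k = Z g ?r ^ (k - 1) * Z g ?r" using k by (cases k) auto
  have "C * real k * Z g ?r ^ (k - 1) * \<psi> g ?r
     = C * (real k - real N) * Z g ?r ^ k - ?r ^ k * b ?r * Z g ?r ^ k + Z g ?r ^ (k - 1) * \<phi> g ?r"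
    unfolding \<psi>_def zk using C_pos k by (simp add: field_simps)
  then show ?thesis
    unfolding radial_hessian_operator[OF k(1)] radial_gradient N[symmetric] C_binomial Z_power_\<phi>[OF g norm_ge_zero]
    by (simp add: Z_nonneg power_mult_distrib algebra_simps)
qed

section \<open>The integral operator of one equation\<close>

definition T :: "(real \<Rightarrow> real) \<Rightarrow> real \<Rightarrow> real" where
  "T g r = integral {0..r} (V g)"

lemma T_0: "T g 0 = 0"
  by (simp add: T_def)

lemma V_integrable:
  assumes "continuous_on {0..} g" "\<And>t. 0 \<le> t \<Longrightarrow> 0 \<le> g t"
  shows "V g integrable_on {0..r}"
  by (rule integrable_continuous_real[OF continuous_on_subset[OF V_cont[OF assms]]]) auto

lemma T_mono:
  assumes "continuous_on {0..} g" "continuous_on {0..} g'" "\<And>t. 0 \<le> t \<Longrightarrow> 0 \<le> g t"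
    and le: "\<And>t. 0 \<le> t \<Longrightarrow> g t \<le> g' t"
  shows "T g r \<le> T g' r"
  unfolding T_def
proof (rule integral_le)
  show "V g integrable_on {0..r}" by (intro V_integrable assms)
  show "V g' integrable_on {0..r}"
    by (intro V_integrable assms) (use assms(3) le order_trans in blast)
qed (intro V_mono assms, auto)

lemma T_deriv:
  assumes "continuous_on {0..} g" "\<And>t. 0 \<le> t \<Longrightarrow> 0 \<le> g t" "0 \<le> r"
  shows "(T g has_real_derivative V g r) (at r within {0..})"
  unfolding T_def[abs_def] by (intro integral_has_real_derivative_halfline V_cont assms)

lemma T_cont:
  assumes "continuous_on {0..} g" "\<And>t. 0 \<le> t \<Longrightarrow> 0 \<le> g t"
  shows "continuous_on {0..} (T g)"
  using T_deriv[OF assms] by (intro has_real_derivative_continuous_on) auto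

lemma T_incr:
  assumes "continuous_on {0..} g" "\<And>t. 0 \<le> t \<Longrightarrow> 0 \<le> g t" "0 \<le> r" "r \<le> s"
  shows "T g r \<le> T g s"
  unfolding T_def
  by (rule integral_subset_le) (use assms V_integrable[OF assms(1,2)] V_nonneg in auto)

lemma T_1: "0 \<le> r \<Longrightarrow> T (\<lambda>_. 1) r = P_fun N k b p r"
  by (simp add: T_def P_fun_eq)

lemma T_const:
  assumes "0 \<le> c" "0 \<le> r"
  shows "T (\<lambda>_. c) r = c powr (1 / real k) * P_fun N k b p r"
proof -
  have "T (\<lambda>_. c) r = integral {0..r} (\<lambda>y. c powr (1 / real k) * V (\<lambda>_. 1) y)"
    unfolding T_def by (rule integral_cong) (use V_const[OF assms(1)] in auto)
  then show ?thesis by (simp only: integral_mult_right flip: T_1[OF assms(2)]) (simp only: T_def)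
qed

lemma P_fun_mono: "0 \<le> r \<Longrightarrow> r \<le> s \<Longrightarrow> P_fun N k b p r \<le> P_fun N k b p s"
  using T_incr[of "\<lambda>_. 1" r s] by (simp add: T_1)

lemma P_fun_nonneg: "0 \<le> r \<Longrightarrow> 0 \<le> P_fun N k b p r"
  using P_fun_mono[of 0 r] T_0[of "\<lambda>_. 1"] by (simp add: T_1)

lemma T_tendsto:
  fixes g :: "nat \<Rightarrow> real \<Rightarrow> real"
  assumes cont: "\<And>n. continuous_on {0..} (g n)"
    and bounds: "\<And>n t. 0 \<le> t \<Longrightarrow> 0 \<le> g n t" "\<And>n t. 0 \<le> t \<Longrightarrow> g n t \<le> K"
    and lim: "\<And>t. 0 \<le> t \<Longrightarrow> (\<lambda>n. g n t) \<longlonglongrightarrow> h t"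
    and r: "0 \<le> r"
  shows "V h integrable_on {0..r}" and "(\<lambda>n. T (g n) r) \<longlonglongrightarrow> T h r"
proof -
  have K: "0 \<le> K" using bounds[of 0] order_trans by blast
  have M: "(\<lambda>n. M (g n) y) \<longlonglongrightarrow> M h y" if y: "0 \<le> y" for y
    unfolding M_def
  proof (rule dominated_convergence)
    fix n show "(\<lambda>s. s ^ (N - 1) * (exp (E (y * s)) * p (y * s) * g n (y * s))) integrable_on {0..1}"
      by (intro M_integrable cont y)
  next
    show "(\<lambda>s. s ^ (N - 1) * (exp (E (y * s)) * p (y * s) * K)) integrable_on {0..1}"
      using M_integrable[of "\<lambda>_. K" y] y by simp
  next
    fix n and s :: real assume "s \<in> {0..1}"
    then show "norm (s ^ (N - 1) * (exp (E (y * s)) * p (y * s) * g n (y * s)))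
        \<le> s ^ (N - 1) * (exp (E (y * s)) * p (y * s) * K)"
      using y p_nonneg[of "y * s"] bounds[of "y * s" n]
      by (simp add: abs_mult mult_left_mono)
  next
    fix s :: real assume "s \<in> {0..1}"
    then show "(\<lambda>n. s ^ (N - 1) * (exp (E (y * s)) * p (y * s) * g n (y * s)))
        \<longlonglongrightarrow> s ^ (N - 1) * (exp (E (y * s)) * p (y * s) * h (y * s))"
      using y by (intro tendsto_intros lim) auto
  qed
  have V: "(\<lambda>n. V (g n) y) \<longlonglongrightarrow> V h y" if y: "0 \<le> y" for y
  proof -
    have "(\<lambda>n. \<zeta> (g n) y) \<longlonglongrightarrow> \<zeta> h y"
      unfolding \<zeta>_def by (intro tendsto_intros M y)
    then show ?thesis
      unfolding V_def Z_def
      using \<zeta>_nonneg[OF cont y bounds(1)] k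
      by (intro tendsto_mult tendsto_const tendsto_powr') auto
  qed
  have int: "V (g n) integrable_on {0..r}" for n by (intro V_integrable cont bounds)
  have intK: "V (\<lambda>_. K) integrable_on {0..r}" by (intro V_integrable) (use K in auto)
  have dom: "norm (V (g n) y) \<le> V (\<lambda>_. K) y" if "y \<in> {0..r}" for n y
    using V_mono[OF cont continuous_on_const, of y n K] that bounds V_nonneg[of y "g n"] by auto
  have conv: "(\<lambda>n. V (g n) y) \<longlonglongrightarrow> V h y" if "y \<in> {0..r}" for y using V that by simp
  show "V h integrable_on {0..r}" "(\<lambda>n. T (g n) r) \<longlonglongrightarrow> T h r"
    unfolding T_def using dominated_convergence[OF int intK dom conv] by auto
qed

end

section \<open>Monotone iteration for the system\<close>

text \<open>\<open>Lim\<close> carries information only once convergence is known; a monotone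
  function converges in \<open>ereal\<close> to its supremum, finite or not.\<close>

lemma at_infty_SUP:
  assumes "\<And>r s. a \<le> r \<Longrightarrow> r \<le> s \<Longrightarrow> g r \<le> g s"
  shows "at_infty g = (SUP r\<in>{a..}. ereal (g r))"
  unfolding at_infty_def
proof (rule tendsto_Lim)
  show "((\<lambda>r. ereal (g r)) \<longlongrightarrow> (SUP r\<in>{a..}. ereal (g r))) at_top"
  proof (rule increasing_tendsto)
    show "\<forall>\<^sub>F r in at_top. ereal (g r) \<le> (SUP r\<in>{a..}. ereal (g r))"
      using eventually_ge_at_top[of a] by eventually_elim (auto intro: SUP_upper)
    fix x assume "x < (SUP r\<in>{a..}. ereal (g r))"
    then obtain r where r: "a \<le> r" "x < ereal (g r)" by (auto simp: less_SUP_iff)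
    show "\<forall>\<^sub>F s in at_top. x < ereal (g s)"
      using eventually_ge_at_top[of r]
    proof eventually_elim
      case (elim s)
      then have "ereal (g r) \<le> ereal (g s)" using assms[of r s] r by simp
      with r(2) show ?case by (rule less_le_trans)
    qed
  qed
qed simp

section \<open>Properties of the nonlinearities\<close>

lemma admissible_nonneg: "admissible_nonlinearity f \<Longrightarrow> 0 \<le> s \<Longrightarrow> 0 \<le> t \<Longrightarrow> 0 \<le> f s t"
  by (simp add: admissible_nonlinearity_def)

lemma admissible_cont:
  "admissible_nonlinearity f \<Longrightarrow> continuous_on ({0..} \<times> {0..}) (\<lambda>(s, t). f s t)"
  by (simp add: admissible_nonlinearity_def)

lemma admissible_strict_mono1:
  "admissible_nonlinearity f \<Longrightarrow> 0 \<le> s \<Longrightarrow> s < s' \<Longrightarrow> 0 \<le> t \<Longrightarrow> f s t < f s' t"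
  by (auto simp: admissible_nonlinearity_def strict_mono_on_def)

lemma admissible_strict_mono2:
  "admissible_nonlinearity f \<Longrightarrow> 0 \<le> s \<Longrightarrow> 0 \<le> t \<Longrightarrow> t < t' \<Longrightarrow> f s t < f s t'"
  by (auto simp: admissible_nonlinearity_def strict_mono_on_def)

lemma admissible_mono:
  assumes f: "admissible_nonlinearity f" and "0 \<le> s" "s \<le> s'" "0 \<le> t" "t \<le> t'"
  shows "f s t \<le> f s' t'"
proof -
  have "f s t \<le> f s' t"
    using admissible_strict_mono1[OF f, of s s' t] assms by (cases "s = s'") auto
  also have "\<dots> \<le> f s' t'"
    using admissible_strict_mono2[OF f, of s' t t'] assms by (cases "t = t'") auto
  finally show ?thesis .
qed

text \<open>Strict monotonicity in a positive variable lifts the value above the nonnegative one on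
  the axis. So the central source is positive even if one of \<open>a1\<close>, \<open>a2\<close> is
  0.\<close>

lemma admissible_pos:
  assumes f: "admissible_nonlinearity f" and "0 \<le> s" "0 \<le> t" "0 < s + t"
  shows "0 < f s t"
proof (cases "0 < s")
  case True
  then show ?thesis
    using admissible_strict_mono1[OF f, of 0 s t] admissible_nonneg[OF f, of 0 t] assms by simp
next
  case False
  then show ?thesis
    using admissible_strict_mono2[OF f, of s 0 t] admissible_nonneg[OF f, of s 0] assms by simp
qed

lemma admissible_continuous:
  assumes f: "admissible_nonlinearity f"
    and "continuous_on S u" "continuous_on S v" "\<And>t. t \<in> S \<Longrightarrow> 0 \<le> u t" "\<And>t. t \<in> S \<Longrightarrow> 0 \<le> v t"
  shows "continuous_on S (\<lambda>t. f (u t) (v t))"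
proof -
  have "continuous_on S (\<lambda>t. (\<lambda>(s, t). f s t) (u t, v t))"
    by (rule continuous_on_compose2[OF admissible_cont[OF f]]) (use assms(2-) in \<open>auto intro!: continuous_on_Pair\<close>)
  then show ?thesis by simp
qed

lemma admissible_tendsto:
  fixes u v :: "nat \<Rightarrow> real"
  assumes f: "admissible_nonlinearity f"
    and "u \<longlonglongrightarrow> s" "v \<longlonglongrightarrow> t" "\<And>n. 0 \<le> u n" "\<And>n. 0 \<le> v n"
  shows "(\<lambda>n. f (u n) (v n)) \<longlonglongrightarrow> f s t"
proof -
  have "0 \<le> s" using LIMSEQ_le_const[OF assms(2)] assms(4) by blast
  moreover have "0 \<le> t" using LIMSEQ_le_const[OF assms(3)] assms(5) by blast
  ultimately have "(\<lambda>n. (\<lambda>(s, t). f s t) (u n, v n)) \<longlonglongrightarrow> (\<lambda>(s, t). f s t) (s, t)"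
    by (intro continuous_on_tendsto_compose[OF admissible_cont[OF f]] tendsto_Pair assms(2,3))
       (simp_all add: assms(4,5))
  then show ?thesis by simp
qed

section \<open>The coupled system and its a priori bound\<close>

locale radial_system =
  eq1: radial_equation N k1 b1 p1 + eq2: radial_equation N k2 b2 p2
  for N k1 k2 :: nat and b1 p1 b2 p2 :: "real \<Rightarrow> real" +
  fixes f1 f2 :: "real \<Rightarrow> real \<Rightarrow> real" and a1 a2 :: real
  assumes f1: "admissible_nonlinearity f1" and f2: "admissible_nonlinearity f2"
    and a: "0 \<le> a1" "0 \<le> a2" "0 < a1 + a2"
begin

abbreviation "P1 \<equiv> P_fun N k1 b1 p1"
abbreviation "P2 \<equiv> P_fun N k2 b2 p2"
abbreviation "F \<equiv> F_fun k1 k2 f1 f2 (a1 + a2)"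
abbreviation "\<Phi> \<equiv> \<lambda>t. f1 t t powr (1 / real k1) + f2 t t powr (1 / real k2)"

lemma \<Phi>_pos:
  assumes "a1 + a2 \<le> t" shows "0 < \<Phi> t"
  using admissible_pos[OF f1, of t t] admissible_pos[OF f2, of t t] assms a by (simp add: add_pos_pos)

lemma F_deriv:
  assumes "a1 + a2 \<le> t"
  shows "(F has_real_derivative 1 / \<Phi> t) (at t within {a1 + a2..})"
proof -
  have c: "continuous_on {a1 + a2..} (\<lambda>t. f t t)" if "admissible_nonlinearity f" for f
    by (rule admissible_continuous[OF that continuous_on_id continuous_on_id]) (use a in auto)
  have "\<forall>t\<in>{a1 + a2..}. f1 t t \<noteq> 0" "\<forall>t\<in>{a1 + a2..}. f2 t t \<noteq> 0"
    using admissible_pos[OF f1] admissible_pos[OF f2] a by (auto simp: less_imp_neq[symmetric])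
  moreover have "\<forall>t\<in>{a1 + a2..}. \<Phi> t \<noteq> 0"
    using \<Phi>_pos by (metis atLeast_iff less_irrefl)
  ultimately have "continuous_on {a1 + a2..} (\<lambda>t. 1 / \<Phi> t)"
    by (intro continuous_on_divide continuous_on_add continuous_on_powr continuous_on_const c f1 f2)
  from integral_has_real_derivative_halfline[OF this assms] show ?thesis
    by (simp add: F_fun_def[abs_def])
qed

lemma F_strict_mono:
  assumes "a1 + a2 \<le> s" "s < t"
  shows "F s < F t"
proof (rule DERIV_pos_imp_increasing_open[OF assms(2)])
  fix x assume x: "s < x" "x < t"
  then have "at x within {a1 + a2..} = at x" using assms by (intro at_within_interior) auto
  then have "(F has_real_derivative 1 / \<Phi> x) (at x)" using F_deriv[of x] x assms by simp
  moreover have "0 < 1 / \<Phi> x" using \<Phi>_pos[of x] x assms by simp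
  ultimately show "\<exists>y. (F has_real_derivative y) (at x) \<and> 0 < y" by blast
next
  show "continuous_on {s..t} F"
    by (rule continuous_on_subset[OF has_real_derivative_continuous_on[OF F_deriv]]) (use assms in auto)
qed

lemma F_le_iff:
  assumes "a1 + a2 \<le> s" "a1 + a2 \<le> t"
  shows "F s \<le> F t \<longleftrightarrow> s \<le> t"
  using F_strict_mono[of s t] F_strict_mono[of t s] assms by (cases s t rule: linorder_cases) auto

lemma F_0: "F (a1 + a2) = 0"
  by (simp add: F_fun_def)

text \<open>The invariant of the iteration. Monotonicity in \<open>r\<close> bounds the source on
  \<open>[0, t]\<close> by its value at \<open>t\<close>; the fixed central values keep it positive
  at 0.\<close>

definition profile :: "(real \<Rightarrow> real) \<Rightarrow> (real \<Rightarrow> real) \<Rightarrow> bool" where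
  "profile u v \<longleftrightarrow> continuous_on {0..} u \<and> continuous_on {0..} v
     \<and> mono_on {0..} u \<and> mono_on {0..} v \<and> u 0 = a1 \<and> v 0 = a2"

lemma profile_mono:
  assumes "profile u v" "0 \<le> s" "s \<le> t"
  shows "u s \<le> u t" "v s \<le> v t"
  using assms by (auto simp: profile_def mono_on_def)

lemma profile_ge:
  assumes "profile u v" "0 \<le> t"
  shows "a1 \<le> u t" "a2 \<le> v t" "0 \<le> u t" "0 \<le> v t"
  using profile_mono[OF assms(1), of 0 t] assms a by (auto simp: profile_def)

lemma regular_source_profile:
  assumes "profile u v" "admissible_nonlinearity f"
  shows "regular_source (\<lambda>t. f (u t) (v t))"
  unfolding regular_source_def
proof (intro conjI)
  show "continuous_on {0..} (\<lambda>t. f (u t) (v t))"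
    by (rule admissible_continuous[OF assms(2)])
       (use assms(1) profile_ge[OF assms(1)] in \<open>auto simp: profile_def\<close>)
  show "mono_on {0..} (\<lambda>t. f (u t) (v t))"
    by (auto simp: mono_on_def intro!: admissible_mono[OF assms(2)] profile_ge(3,4)[OF assms(1)] profile_mono[OF assms(1)])
  show "0 < f (u 0) (v 0)"
    using assms(1) admissible_pos[OF assms(2) a] by (simp add: profile_def)
qed

definition step1 :: "(real \<Rightarrow> real) \<Rightarrow> (real \<Rightarrow> real) \<Rightarrow> real \<Rightarrow> real" where
  "step1 u v r = a1 + eq1.T (\<lambda>t. f1 (u t) (v t)) r"

definition step2 :: "(real \<Rightarrow> real) \<Rightarrow> (real \<Rightarrow> real) \<Rightarrow> real \<Rightarrow> real" where
  "step2 u v r = a2 + eq2.T (\<lambda>t. f2 (u t) (v t)) r"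

lemma source_cont_nonneg:
  assumes "profile u v" "admissible_nonlinearity f"
  shows "continuous_on {0..} (\<lambda>t. f (u t) (v t))" "0 \<le> t \<Longrightarrow> 0 \<le> f (u t) (v t)"
  using regular_source_profile[OF assms] admissible_nonneg[OF assms(2)] profile_ge[OF assms(1)]
  by (auto simp: regular_source_def)

lemma profile_step:
  assumes uv: "profile u v"
  shows "profile (step1 u v) (step2 u v)"
proof -
  note src1 = source_cont_nonneg[OF uv f1] and src2 = source_cont_nonneg[OF uv f2]
  have "continuous_on {0..} (step1 u v)" "continuous_on {0..} (step2 u v)"
    unfolding step1_def[abs_def] step2_def[abs_def]
    by (intro continuous_on_add continuous_on_const eq1.T_cont eq2.T_cont src1 src2; assumption)+
  moreover have "mono_on {0..} (step1 u v)" "mono_on {0..} (step2 u v)"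
    unfolding step1_def[abs_def] step2_def[abs_def] mono_on_def
    using eq1.T_incr[OF src1] eq2.T_incr[OF src2] by auto
  ultimately show ?thesis
    by (simp add: profile_def step1_def step2_def eq1.T_0 eq2.T_0)
qed

lemma step_mono:
  assumes uv: "profile u v" and uv': "profile u' v'"
    and le: "\<And>t. 0 \<le> t \<Longrightarrow> u t \<le> u' t" "\<And>t. 0 \<le> t \<Longrightarrow> v t \<le> v' t"
  shows "step1 u v r \<le> step1 u' v' r" "step2 u v r \<le> step2 u' v' r"
proof -
  show "step1 u v r \<le> step1 u' v' r"
    unfolding step1_def
    by (intro add_left_mono eq1.T_mono source_cont_nonneg[OF uv f1] source_cont_nonneg(1)[OF uv' f1]
        admissible_mono[OF f1] le profile_ge(3,4)[OF uv])
  show "step2 u v r \<le> step2 u' v' r"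
    unfolding step2_def
    by (intro add_left_mono eq2.T_mono source_cont_nonneg[OF uv f2] source_cont_nonneg(1)[OF uv' f2]
        admissible_mono[OF f2] le profile_ge(3,4)[OF uv])
qed

text \<open>The sum \<open>S\<close> of the two components satisfies \<open>S' \<le> \<Phi>(S) (P\<^sub>1' + P\<^sub>2')\<close>, and \<open>F' = 1 / \<Phi>\<close>.\<close>

lemma F_step_le:
  assumes uv: "profile u v"
    and le: "\<And>t. 0 \<le> t \<Longrightarrow> u t \<le> step1 u v t" "\<And>t. 0 \<le> t \<Longrightarrow> v t \<le> step2 u v t"
    and r: "0 \<le> r"
  shows "F (step1 u v r + step2 u v r) \<le> P1 r + P2 r"
proof -
  define S where "S r = step1 u v r + step2 u v r" for r
  let ?g1 = "\<lambda>t. f1 (u t) (v t)" and ?g2 = "\<lambda>t. f2 (u t) (v t)"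
  note src1 = source_cont_nonneg[OF uv f1] and src2 = source_cont_nonneg[OF uv f2]
  note st = profile_ge[OF profile_step[OF uv]]
  have S_ge: "a1 + a2 \<le> S t" if "0 \<le> t" for t
    using st[OF that] by (simp add: S_def)
  have S_deriv: "(S has_real_derivative eq1.V ?g1 t + eq2.V ?g2 t) (at t within {0..})" if "0 \<le> t" for t
    unfolding S_def[abs_def] step1_def[abs_def] step2_def[abs_def]
    using that by (auto intro!: derivative_eq_intros eq1.T_deriv eq2.T_deriv src1 src2)
  have V_le: "eq1.V ?g1 t + eq2.V ?g2 t \<le> \<Phi> (S t) * (eq1.V (\<lambda>_. 1) t + eq2.V (\<lambda>_. 1) t)" if t: "0 \<le> t" for t
  proof -
    have S0: "0 \<le> S t" using S_ge[OF t] a by simp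
    \<comment> \<open>\<open>u s \<le> u t \<le> step1 u v t \<le> S t\<close>, the last step
      because the other component is nonnegative; likewise for \<open>v\<close>. Hence the diagonal
      in \<open>\<Phi>\<close>.\<close>
    have uS: "u s \<le> S t" "v s \<le> S t" if "0 \<le> s" "s \<le> t" for s
      using profile_mono[OF uv that] le[OF t] st[OF t] by (auto simp: S_def)
    have "eq1.V ?g1 t \<le> eq1.V (\<lambda>_. f1 (S t) (S t)) t"
      by (rule eq1.V_mono) (use t src1 uS in \<open>auto intro!: admissible_mono[OF f1] profile_ge(3,4)[OF uv]\<close>)
    moreover have "eq2.V ?g2 t \<le> eq2.V (\<lambda>_. f2 (S t) (S t)) t"
      by (rule eq2.V_mono) (use t src2 uS in \<open>auto intro!: admissible_mono[OF f2] profile_ge(3,4)[OF uv]\<close>)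
    ultimately have "eq1.V ?g1 t + eq2.V ?g2 t \<le> f1 (S t) (S t) powr (1 / real k1) * eq1.V (\<lambda>_. 1) t
        + f2 (S t) (S t) powr (1 / real k2) * eq2.V (\<lambda>_. 1) t"
      using eq1.V_const[of "f1 (S t) (S t)" t] eq2.V_const[of "f2 (S t) (S t)" t] t
        admissible_nonneg[OF f1 S0 S0] admissible_nonneg[OF f2 S0 S0] by simp
    also have "\<dots> \<le> \<Phi> (S t) * (eq1.V (\<lambda>_. 1) t + eq2.V (\<lambda>_. 1) t)"
      using eq1.V_nonneg[OF t, of "\<lambda>_. 1"] eq2.V_nonneg[OF t, of "\<lambda>_. 1"] by (simp add: algebra_simps)
    finally show ?thesis .
  qed
  \<comment> \<open>The differential inequality is integrated as monotonicity of \<open>D\<close>,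
    which starts at 0 because \<open>S 0 = a1 + a2\<close>.\<close>
  define D where "D t = P1 t + P2 t - F (S t)" for t
  have D_deriv: "(D has_real_derivative (eq1.V (\<lambda>_. 1) t + eq2.V (\<lambda>_. 1) t)
      - 1 / \<Phi> (S t) * (eq1.V ?g1 t + eq2.V ?g2 t)) (at t within {0..})" if t: "0 \<le> t" for t
  proof -
    have "(F has_real_derivative 1 / \<Phi> (S t)) (at (S t) within S ` {0..})"
      by (rule has_field_derivative_subset[OF F_deriv[OF S_ge[OF t]]]) (use S_ge in auto)
    from DERIV_image_chain[OF this S_deriv[OF t]]
    show ?thesis
      unfolding D_def[abs_def] o_def by (intro DERIV_diff DERIV_add eq1.P_deriv eq2.P_deriv t)
  qed
  have "D 0 \<le> D r"
  proof (rule DERIV_nonneg_imp_increasing_open[OF r])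
    fix t assume t: "0 < t" "t < r"
    then have "at t within {0..} = at t" by (intro at_within_interior) simp
    moreover have "0 \<le> (eq1.V (\<lambda>_. 1) t + eq2.V (\<lambda>_. 1) t) - 1 / \<Phi> (S t) * (eq1.V ?g1 t + eq2.V ?g2 t)"
      using V_le[of t] \<Phi>_pos[OF S_ge[of t]] t by (simp add: pos_divide_le_eq mult.commute)
    ultimately show "\<exists>y. (D has_real_derivative y) (at t) \<and> 0 \<le> y"
      using D_deriv[of t] t by auto
  next
    show "continuous_on {0..r} D"
      by (rule continuous_on_subset[OF has_real_derivative_continuous_on[OF D_deriv]]) auto
  qed
  moreover have "D 0 = 0"
    using eq1.T_1[of 0] eq2.T_1[of 0] F_0
    by (simp add: D_def S_def step1_def step2_def eq1.T_0 eq2.T_0)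
  ultimately show ?thesis by (simp add: D_def S_def)
qed

section \<open>Picard iterates and their limit\<close>

primrec picard :: "nat \<Rightarrow> (real \<Rightarrow> real) \<times> (real \<Rightarrow> real)" where
  "picard 0 = (\<lambda>_. a1, \<lambda>_. a2)"
| "picard (Suc n) = (step1 (fst (picard n)) (snd (picard n)), step2 (fst (picard n)) (snd (picard n)))"

abbreviation "u n \<equiv> fst (picard n)"
abbreviation "v n \<equiv> snd (picard n)"

lemma profile_picard: "profile (u n) (v n)"
proof (induction n)
  case 0
  then show ?case by (simp add: profile_def mono_on_def)
qed (simp add: profile_step)

lemma picard_incr:
  assumes "0 \<le> t"
  shows "u n t \<le> u (Suc n) t" "v n t \<le> v (Suc n) t"
proof -
  \<comment> \<open>The induction treats all radii at once, since a step at \<open>t\<close>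
    integrates over \<open>[0, t]\<close>.\<close>
  have "\<forall>t\<ge>0. u n t \<le> u (Suc n) t \<and> v n t \<le> v (Suc n) t"
  proof (induction n)
    case 0
    then show ?case using profile_ge[OF profile_picard[of 1]] by simp
  next
    case (Suc n)
    then show ?case
      using step_mono[OF profile_picard[of n] profile_picard[of "Suc n"]] by simp
  qed
  then show "u n t \<le> u (Suc n) t" "v n t \<le> v (Suc n) t" using assms by auto
qed

text \<open>\<open>F_step_le\<close> bounds the sum at index \<open>Suc n\<close> by
  \<open>B\<close>; index \<open>n\<close> lies below it, and each component lies below the
  sum.\<close>

lemma picard_bound:
  assumes B: "a1 + a2 \<le> B" "\<And>r. 0 \<le> r \<Longrightarrow> P1 r + P2 r \<le> F B" and t: "0 \<le> t"
  shows "u n t \<le> B" "v n t \<le> B"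
proof -
  note ge = profile_ge[OF profile_picard t]
  have "F (u (Suc n) t + v (Suc n) t) \<le> P1 t + P2 t"
    using F_step_le[OF profile_picard[of n] _ _ t] picard_incr[of _ n] by simp
  also have "\<dots> \<le> F B" by (rule B(2)[OF t])
  finally have "u (Suc n) t + v (Suc n) t \<le> B"
    using F_le_iff[OF _ B(1)] ge[of "Suc n"] add_mono by blast
  then show "u n t \<le> B" "v n t \<le> B"
    using picard_incr[OF t, of n] ge[of "Suc n"] by auto
qed

lemma ex_fixed_point:
  assumes B: "a1 + a2 \<le> B" "\<And>r. 0 \<le> r \<Longrightarrow> P1 r + P2 r \<le> F B"
  shows "\<exists>x y. profile x y \<and> (\<forall>r\<ge>0. x r = step1 x y r) \<and> (\<forall>r\<ge>0. y r = step2 x y r)"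
proof -
  define x where "x t = lim (\<lambda>n. u n t)" for t
  define y where "y t = lim (\<lambda>n. v n t)" for t
  have x: "(\<lambda>n. u n t) \<longlonglongrightarrow> x t" and y: "(\<lambda>n. v n t) \<longlonglongrightarrow> y t" if t: "0 \<le> t" for t
  proof -
    have "incseq (\<lambda>n. u n t)" "incseq (\<lambda>n. v n t)"
      using picard_incr[OF t] by (intro incseq_SucI; blast)+
    moreover have "\<forall>n. u n t \<le> B" "\<forall>n. v n t \<le> B" using picard_bound[OF B t] by auto
    ultimately have "convergent (\<lambda>n. u n t)" "convergent (\<lambda>n. v n t)"
      by (auto elim!: incseq_convergent intro: convergentI)
    then show "(\<lambda>n. u n t) \<longlonglongrightarrow> x t" "(\<lambda>n. v n t) \<longlonglongrightarrow> y t"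
      by (simp_all add: convergent_LIMSEQ_iff x_def y_def)
  qed
  note ge = profile_ge[OF profile_picard]
  \<comment> \<open>These are the premises of \<open>T_tendsto\<close> for either nonlinearity, with
    the common bound \<open>K = f B B\<close>.\<close>
  have src: "0 \<le> f (u n t) (v n t)" "f (u n t) (v n t) \<le> f B B" "(\<lambda>n. f (u n t) (v n t)) \<longlonglongrightarrow> f (x t) (y t)"
    if "admissible_nonlinearity f" "0 \<le> t" for f n t
    using admissible_nonneg[OF that(1) ge(3,4)[OF that(2)]]
      admissible_mono[OF that(1) ge(3)[OF that(2)] picard_bound(1)[OF B that(2)]
        ge(4)[OF that(2)] picard_bound(2)[OF B that(2)]]
      admissible_tendsto[OF that(1) x[OF that(2)] y[OF that(2)] ge(3,4)[OF that(2)]]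
    by simp_all
  note T1 = eq1.T_tendsto[OF source_cont_nonneg(1)[OF profile_picard f1] src[OF f1]]
  note T2 = eq2.T_tendsto[OF source_cont_nonneg(1)[OF profile_picard f2] src[OF f2]]
  have xr: "x r = step1 x y r" if r: "0 \<le> r" for r
  proof -
    have "(\<lambda>n. u (Suc n) r) \<longlonglongrightarrow> step1 x y r"
      unfolding step1_def picard.simps fst_conv by (intro tendsto_intros T1(2) r)
    then show ?thesis by (rule LIMSEQ_unique[OF LIMSEQ_Suc[OF x[OF r]]])
  qed
  have yr: "y r = step2 x y r" if r: "0 \<le> r" for r
  proof -
    have "(\<lambda>n. v (Suc n) r) \<longlonglongrightarrow> step2 x y r"
      unfolding step2_def picard.simps snd_conv by (intro tendsto_intros T2(2) r)
    then show ?thesis by (rule LIMSEQ_unique[OF LIMSEQ_Suc[OF y[OF r]]])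
  qed
  \<comment> \<open>\<open>x\<close> and \<open>y\<close> are only pointwise limits. Continuity
    comes from the primitives, whose integrands are integrable by the first conclusion of
    \<open>T_tendsto\<close>.\<close>
  have cont: "continuous_on {0..} (step1 x y)" "continuous_on {0..} (step2 x y)"
    unfolding step1_def[abs_def] step2_def[abs_def] eq1.T_def eq2.T_def
    by (intro continuous_on_halflineI continuous_on_add continuous_on_const
        indefinite_integral_continuous_1 T1(1) T2(1); assumption)+
  have "continuous_on {0..} x" "continuous_on {0..} y"
    by (rule continuous_on_eq[OF cont(1)], simp add: xr, rule continuous_on_eq[OF cont(2)], simp add: yr)
  moreover have "x s \<le> x t" "y s \<le> y t" if "0 \<le> s" "s \<le> t" for s t
  proof -
    have t: "0 \<le> t" using that by simp
    show "x s \<le> x t" "y s \<le> y t"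
      using LIMSEQ_le[OF x[OF that(1)] x[OF t]] LIMSEQ_le[OF y[OF that(1)] y[OF t]]
        profile_mono[OF profile_picard that] by simp_all
  qed
  moreover have "x 0 = a1" "y 0 = a2"
    using xr[of 0] yr[of 0] by (simp_all add: step1_def step2_def eq1.T_0 eq2.T_0)
  ultimately have "profile x y" by (simp add: profile_def mono_on_def)
  moreover have "\<forall>r\<ge>0. x r = step1 x y r" "\<forall>r\<ge>0. y r = step2 x y r"
    using xr yr by auto
  ultimately show ?thesis by (intro exI conjI)
qed

section \<open>Bounds from the limits at infinity, and the inverse of \<open>F\<close>\<close>

lemma F_bound_ex:
  assumes "at_infty P1 + at_infty P2 < at_infty F"
  shows "\<exists>B\<ge>a1 + a2. \<forall>r\<ge>0. P1 r + P2 r \<le> F B"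
proof -
  have "F r \<le> F s" if "a1 + a2 \<le> r" "r \<le> s" for r s
    using F_le_iff[of r s] that by simp
  then have "at_infty F = (SUP r\<in>{a1 + a2..}. ereal (F r))" by (rule at_infty_SUP)
  \<comment> \<open>A strict inequality below a supremum is attained at a finite point.\<close>
  with assms obtain B where B: "a1 + a2 \<le> B" "at_infty P1 + at_infty P2 < ereal (F B)"
    by (auto simp: less_SUP_iff)
  have inf1: "at_infty P1 = (SUP r\<in>{0..}. ereal (P1 r))"
    by (rule at_infty_SUP) (rule eq1.P_fun_mono)
  have inf2: "at_infty P2 = (SUP r\<in>{0..}. ereal (P2 r))"
    by (rule at_infty_SUP) (rule eq2.P_fun_mono)
  have "P1 r + P2 r \<le> F B" if r: "0 \<le> r" for r
  proof -
    have "ereal (P1 r) \<le> at_infty P1"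
      unfolding inf1 using SUP_upper[of r "{0..}" "\<lambda>r. ereal (P1 r)"] r by simp
    moreover have "ereal (P2 r) \<le> at_infty P2"
      unfolding inf2 using SUP_upper[of r "{0..}" "\<lambda>r. ereal (P2 r)"] r by simp
    ultimately have "ereal (P1 r) + ereal (P2 r) \<le> at_infty P1 + at_infty P2" by (rule add_mono)
    from le_less_trans[OF this B(2)] show ?thesis by simp
  qed
  with B(1) show ?thesis by blast
qed

text \<open>\<open>y\<close> lies between \<open>F (a1 + a2)\<close> and \<open>F B\<close>, so the
  intermediate value theorem provides a preimage. Outside the range of \<open>F\<close>,
  \<open>the_inv_into\<close> would be unspecified.\<close>

lemma le_F_inv:
  assumes B: "a1 + a2 \<le> B" "y \<le> F B" and s: "a1 + a2 \<le> s" "F s \<le> y"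
  shows "s \<le> F_inv k1 k2 f1 f2 (a1 + a2) y"
proof -
  have "F (a1 + a2) \<le> y" using F_le_iff[of "a1 + a2" s] s by simp
  moreover have "continuous_on {a1 + a2..B} F"
    by (rule continuous_on_subset[OF has_real_derivative_continuous_on[OF F_deriv]]) auto
  ultimately obtain t where t: "a1 + a2 \<le> t" "F t = y"
    using IVT'[of F "a1 + a2" y B] B by blast
  have "inj_on F {a1 + a2..}"
  proof (rule inj_onI)
    fix s t assume "s \<in> {a1 + a2..}" "t \<in> {a1 + a2..}" "F s = F t"
    then show "s = t" using F_le_iff[of s t] F_le_iff[of t s] by auto
  qed
  then have "F_inv k1 k2 f1 f2 (a1 + a2) y = t"
    unfolding F_inv_def using t by (auto simp: the_inv_into_f_f)
  then show ?thesis using F_le_iff[of s t] s t by simp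
qed

end

text \<open>Positivity at \<open>r\<close> is tied to \<open>a_i > 0\<close> or
  \<open>P_i r > 0\<close>: if both vanish, the integral equation gives \<open>u_i r = 0\<close>, as
  it does at \<open>r = 0\<close> when \<open>a_i = 0\<close>.\<close>

theorem theorem2:
  fixes k1 k2 :: nat and a1 a2 :: real
    and b1 b2 p1 p2 :: "real \<Rightarrow> real"
    and f1 f2 :: "real \<Rightarrow> real \<Rightarrow> real"
  defines "N \<equiv> CARD('n::finite)"
  defines "P1 \<equiv> P_fun N k1 b1 p1" and "P2 \<equiv> P_fun N k2 b2 p2"
  defines "F \<equiv> F_fun k1 k2 f1 f2 (a1 + a2)" and "Finv \<equiv> F_inv k1 k2 f1 f2 (a1 + a2)"
  assumes "N \<ge> 3" and "k1 \<in> {1..N}" and "k2 \<in> {1..N}"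
    and "a1 \<ge> 0" and "a2 \<ge> 0" and "a1 + a2 > 0"
    and "nonneg_continuous b1" and "nonneg_continuous b2"
    and "nonneg_continuous p1" and "nonneg_continuous p2"
    and "admissible_nonlinearity f1" and "admissible_nonlinearity f2"
    and "C2_compatible N k1 b1 p1" and "C2_compatible N k2 b2 p2"
    and "at_infty F < \<infinity>"
    and "at_infty P1 + at_infty P2 < \<infinity>"
    and "at_infty P1 + at_infty P2 < at_infty F"
  shows "\<exists>u1 u2 :: real \<Rightarrow> real.
      C2_halfline u1 \<and> C2_halfline u2 \<and>
      C2_space (radial u1 :: real ^ 'n \<Rightarrow> real) \<and> C2_space (radial u2 :: real ^ 'n \<Rightarrow> real) \<and>
      (\<forall>x :: real ^ 'n.
         hessian_operator k1 (radial u1) x + b1 (norm x) * norm (gradient (radial u1) x) ^ k1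
           = p1 (norm x) * f1 (radial u1 x) (radial u2 x) \<and>
         hessian_operator k2 (radial u2) x + b2 (norm x) * norm (gradient (radial u2) x) ^ k2
           = p2 (norm x) * f2 (radial u1 x) (radial u2 x)) \<and>
      (\<forall>r\<ge>0. 0 \<le> u1 r \<and> (0 < a1 \<or> 0 < P1 r \<longrightarrow> 0 < u1 r)) \<and>
      (\<forall>r\<ge>0. 0 \<le> u2 r \<and> (0 < a2 \<or> 0 < P2 r \<longrightarrow> 0 < u2 r)) \<and>
      bounded (u1 ` {0..}) \<and> bounded (u2 ` {0..}) \<and>
      u1 0 = a1 \<and> u2 0 = a2 \<and>
      (\<forall>r\<ge>0. a1 + f1 a1 a2 powr (1 / real k1) * P1 r \<le> u1 r \<and> u1 r \<le> Finv (P1 r + P2 r)) \<and>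
      (\<forall>r\<ge>0. a2 + f2 a1 a2 powr (1 / real k2) * P2 r \<le> u2 r \<and> u2 r \<le> Finv (P1 r + P2 r))"
proof -
  interpret S: radial_system N k1 k2 b1 p1 b2 p2 f1 f2 a1 a2
    by unfold_locales (use assms in auto)
  obtain B where B: "a1 + a2 \<le> B" "\<And>r. 0 \<le> r \<Longrightarrow> P1 r + P2 r \<le> F B"
    using S.F_bound_ex \<open>at_infty P1 + at_infty P2 < at_infty F\<close> unfolding P1_def P2_def F_def by blast
  then obtain x y where xy: "S.profile x y"
    and x: "\<And>r. 0 \<le> r \<Longrightarrow> x r = S.step1 x y r" and y: "\<And>r. 0 \<le> r \<Longrightarrow> y r = S.step2 x y r"
    using S.ex_fixed_point[of B] unfolding P1_def P2_def F_def by blast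
  let ?g1 = "\<lambda>t. f1 (x t) (y t)" and ?g2 = "\<lambda>t. f2 (x t) (y t)"
  note reg1 = S.regular_source_profile[OF xy S.f1] and reg2 = S.regular_source_profile[OF xy S.f2]
  note ge = S.profile_ge[OF xy]
  have xT: "x r = a1 + integral {0..r} (S.eq1.V ?g1)" if "0 \<le> r" for r
    using x[OF that] by (simp add: S.step1_def S.eq1.T_def)
  have yT: "y r = a2 + integral {0..r} (S.eq2.V ?g2)" if "0 \<le> r" for r
    using y[OF that] by (simp add: S.step2_def S.eq2.T_def)
  interpret X: radial_profile x "S.eq1.Z ?g1" "S.eq1.\<psi> ?g1"
    by (rule S.eq1.radial_profile_solution[OF _ reg1 xT]) fact
  interpret Y: radial_profile y "S.eq2.Z ?g2" "S.eq2.\<psi> ?g2"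
    by (rule S.eq2.radial_profile_solution[OF _ reg2 yT]) fact
  have eqs: "hessian_operator k1 (radial x) z + b1 (norm z) * norm (gradient (radial x) z) ^ k1
        = p1 (norm z) * f1 (radial x z) (radial y z)"
      "hessian_operator k2 (radial y) z + b2 (norm z) * norm (gradient (radial y) z) ^ k2
        = p2 (norm z) * f2 (radial x z) (radial y z)" for z :: "real ^ 'n"
    using S.eq1.radial_solution[OF N_def[THEN meta_eq_to_obj_eq] \<open>C2_compatible N k1 b1 p1\<close> reg1 xT, of z]
      S.eq2.radial_solution[OF N_def[THEN meta_eq_to_obj_eq] \<open>C2_compatible N k2 b2 p2\<close> reg2 yT, of z]
    by (simp_all add: radial_def)
  \<comment> \<open>The fixed point satisfies the two inequalities assumed in
    \<open>F_step_le\<close> with equality.\<close>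
  have sum_F: "F (x r + y r) \<le> P1 r + P2 r" if r: "0 \<le> r" for r
    using S.F_step_le[OF xy _ _ r] x y r unfolding P1_def P2_def F_def by auto
  have upper: "x r + y r \<le> Finv (P1 r + P2 r)" and bound: "x r + y r \<le> B" if r: "0 \<le> r" for r
  proof -
    have "a1 + a2 \<le> x r + y r" using ge[OF r] by simp
    then show "x r + y r \<le> Finv (P1 r + P2 r)" "x r + y r \<le> B"
      using S.le_F_inv[of B "P1 r + P2 r" "x r + y r"] S.F_le_iff[of "x r + y r" B] B sum_F[OF r] r
      unfolding Finv_def F_def by force+
  qed
  have fa: "0 < f1 a1 a2" "0 < f2 a1 a2"
    using admissible_pos[OF S.f1 S.a] admissible_pos[OF S.f2 S.a] by auto
  have lower: "a1 + f1 a1 a2 powr (1 / real k1) * P1 r \<le> x r"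
      "a2 + f2 a1 a2 powr (1 / real k2) * P2 r \<le> y r" if r: "0 \<le> r" for r
  proof -
    \<comment> \<open>The components never fall below their central values, so the source dominates
      the constant \<open>f1 a1 a2\<close>.\<close>
    have "S.eq1.T (\<lambda>_. f1 a1 a2) r \<le> S.eq1.T ?g1 r"
      using fa S.source_cont_nonneg[OF xy S.f1]
      by (intro S.eq1.T_mono) (auto intro!: admissible_mono[OF S.f1] ge S.a)
    then show "a1 + f1 a1 a2 powr (1 / real k1) * P1 r \<le> x r"
      using x[OF r] S.eq1.T_const[of "f1 a1 a2" r] fa r by (simp add: P1_def S.step1_def)
    have "S.eq2.T (\<lambda>_. f2 a1 a2) r \<le> S.eq2.T ?g2 r"
      using fa S.source_cont_nonneg[OF xy S.f2]
      by (intro S.eq2.T_mono) (auto intro!: admissible_mono[OF S.f2] ge S.a)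
    then show "a2 + f2 a1 a2 powr (1 / real k2) * P2 r \<le> y r"
      using y[OF r] S.eq2.T_const[of "f2 a1 a2" r] fa r by (simp add: P2_def S.step2_def)
  qed
  have P: "0 \<le> P1 r" "0 \<le> P2 r" if "0 \<le> r" for r
    using S.eq1.P_fun_nonneg[OF that] S.eq2.P_fun_nonneg[OF that] by (auto simp: P1_def P2_def)
  have pos: "0 < x r" if r: "0 \<le> r" "0 < a1 \<or> 0 < P1 r" for r
  proof -
    have "0 < a1 + f1 a1 a2 powr (1 / real k1) * P1 r"
      using r fa S.a P[OF r(1)] by (auto intro: add_pos_nonneg add_nonneg_pos)
    then show ?thesis using lower(1)[OF r(1)] by simp
  qed
  have pos': "0 < y r" if r: "0 \<le> r" "0 < a2 \<or> 0 < P2 r" for r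
  proof -
    have "0 < a2 + f2 a1 a2 powr (1 / real k2) * P2 r"
      using r fa S.a P[OF r(1)] by (auto intro: add_pos_nonneg add_nonneg_pos)
    then show ?thesis using lower(2)[OF r(1)] by simp
  qed
  have le: "x r \<le> B" "y r \<le> B" "x r \<le> Finv (P1 r + P2 r)" "y r \<le> Finv (P1 r + P2 r)" if "0 \<le> r" for r
    using bound[OF that] upper[OF that] ge[OF that] by auto
  have bdd: "bounded (x ` {0..})" "bounded (y ` {0..})"
    by (rule boundedI[of _ B]; use le ge in auto)+
  have "x 0 = a1" "y 0 = a2" using xy by (auto simp: S.profile_def)
  with eqs pos pos' le(3,4) lower ge(3,4) bdd X.C2_halfline Y.C2_halfline
    X.C2_space_radial[where 'n = 'n] Y.C2_space_radial[where 'n = 'n]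
  show ?thesis by (intro exI[of _ x] exI[of _ y]) simp
qed

end
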